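(* Let $\mathcal W=\mathcal F_1\boxtimes\cdots\boxtimes\mathcal F_k$ be a germ of regular $k$-web on $(\mathbb C^2,0)$ which admits a transverse infinitesimal automorphism $X$, and let $\mathcal F_X$ be the foliation induced by $X$. Then $$\mathrm{rk}(\mathcal W\boxtimes\mathcal F_X)=\mathrm{rk}(\mathcal W)+(k-1).$$ In particular, $\mathcal W$ is of maximal rank if and only if the $(k+1)$-web $\mathcal W\boxtimes\mathcal F_X$ is of maximal rank.
   Context: A germ of regular $k$-web $\mathcal W=\mathcal F_1\boxtimes\cdots\boxtimes\mathcal F_k$ on $(\mathbb C^2,0)$ is a collection of $k$ germs of smooth holomorphic foliations $\mathcal F_i$ on $(\mathbb C^2,0)$ such that any two of them have distinct tangent spaces at the origin. If $\mathcal F_i$ is induced by the germ of holomorphic $1$-form $\omega_i$, the space of abelian relations of $\mathcal W$ is the complex vector space $$\mathcal A(\mathcal W)=\Big\{(\eta_i)_{i=1}^k\in(\Omega^1(\mathbb C^2,0))^k \ \Big|\ d\eta_i=0 \text{ and } \eta_i\wedge\omega_i=0 \text{ for all } i,\ \sum_{i=1}^k\eta_i=0\Big\}.$$ It is finite-dimensional; its dimension is the rank $\mathrm{rk}(\mathcal W)$, and $\mathrm{rk}(\mathcal W)\le\frac12(k-1)(k-2)$ (Bol). A $k$-web is of maximal rank if equality holds. A germ of holomorphic vector field $X$ on $(\mathbb C^2,0)$ is an infinitesimal automorphism of $\mathcal W$ if its local flow preserves each foliation $\mathcal F_i$, i.e. $L_X\omega_i\wedge\omega_i=0$ for all $i$,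 where $L_X=i_Xd+di_X$ is the Lie derivative. It is transverse if $X$ is regular (non-vanishing) and transverse to each $\mathcal F_i$ in a neighborhood of the origin, i.e. $\omega_i(X)(0)\ne0$ for every $i$. The foliation $\mathcal F_X$ is the one whose leaves are the orbits of $X$, and $\mathcal W\boxtimes\mathcal F_X=\mathcal F_1\boxtimes\cdots\boxtimes\mathcal F_k\boxtimes\mathcal F_X$. *)

theory Defs
  imports
    "HOL-Analysis.Analysis"
    "HOL-Complex_Analysis.Complex_Analysis"
    "HOL-Library.Function_Algebras"
begin

section \<open>Holomorphic functions of two variables\<close>

type_synonym C2 = "complex \<times> complex"

text \<open>Differentiable with complex linear derivative.\<close>

definition complex_diff_at :: "(C2 \<Rightarrow> complex) \<Rightarrow> C2 \<Rightarrow> bool" where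
  "complex_diff_at f p \<longleftrightarrow>
     (\<exists>a b. (f has_derivative (\<lambda>v. a * fst v + b * snd v)) (at p))"

definition holomorphic_near0 :: "(C2 \<Rightarrow> complex) \<Rightarrow> bool" where
  "holomorphic_near0 f \<longleftrightarrow> (\<forall>\<^sub>F p in nhds 0. complex_diff_at f p)"

definition pd1 :: "(C2 \<Rightarrow> complex) \<Rightarrow> C2 \<Rightarrow> complex" where
  "pd1 f p = deriv (\<lambda>x. f (x, snd p)) (fst p)"

definition pd2 :: "(C2 \<Rightarrow> complex) \<Rightarrow> C2 \<Rightarrow> complex" where
  "pd2 f p = deriv (\<lambda>y. f (fst p, y)) (snd p)"

lemma complex_diff_at_partials:
  assumes "(f has_derivative (\<lambda>v. a * fst v + b * snd v)) (at p)"
  shows "((\<lambda>x. f (x, snd p)) has_field_derivative a) (at (fst p))"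
    and "((\<lambda>y. f (fst p, y)) has_field_derivative b) (at (snd p))"
    and "pd1 f p = a" and "pd2 f p = b"
proof -
  have f: "(f has_derivative (\<lambda>v. a * fst v + b * snd v)) (at (fst p, snd p))"
    using assms by simp
  have "((\<lambda>x. (x, snd p)) has_derivative (\<lambda>h. (h, 0))) (at (fst p))"
    by (auto intro!: derivative_eq_intros)
  from has_derivative_compose[OF this f]
  show 1: "((\<lambda>x. f (x, snd p)) has_field_derivative a) (at (fst p))"
    by (simp add: has_field_derivative_def)
  have "((\<lambda>y. (fst p, y)) has_derivative (\<lambda>h. (0, h))) (at (snd p))"
    by (auto intro!: derivative_eq_intros)
  from has_derivative_compose[OF this f]
  show 2: "((\<lambda>y. f (fst p, y)) has_field_derivative b) (at (snd p))"
    by (simp add: has_field_derivative_def)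
  show "pd1 f p = a" "pd2 f p = b"
    using 1 2 by (auto simp: pd1_def pd2_def DERIV_imp_deriv)
qed

lemma pd1_integral:
  assumes "continuous_on (cball z0 r) (\<lambda>z. f (z, w))" "(\<lambda>z. f (z, w)) holomorphic_on ball z0 r"
    and z: "z \<in> ball z0 r"
  shows "pd1 f (z, w) = integral (cbox 0 1)
     (\<lambda>t. f (circlepath z0 r t, w) / (circlepath z0 r t - z)^2 *
       (2 * of_real pi * \<i> * r * exp (2 * of_real pi * \<i> * t))) / (2 * of_real pi * \<i>)"
proof -
  have "((\<lambda>z. f (z, w)) has_field_derivative (1 / (2 * of_real pi * \<i>) *
      contour_integral (circlepath z0 r) (\<lambda>u. f (u, w) / (u-z)^2))) (at z)"
    using Cauchy_derivative_integral_circlepath(2)[OF assms] .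
  then have "pd1 f (z, w) = contour_integral (circlepath z0 r) (\<lambda>u. f (u, w) / (u-z)^2) / (2 * of_real pi * \<i>)"
    by (simp add: pd1_def DERIV_imp_deriv)
  also have "contour_integral (circlepath z0 r) (\<lambda>u. f (u, w) / (u-z)^2) =
     integral (cbox 0 1) (\<lambda>t. f (circlepath z0 r t, w) / (circlepath z0 r t - z)^2 *
       (2 * of_real pi * \<i> * r * exp (2 * of_real pi * \<i> * t)))"
    by (simp add: contour_integral_integral vector_derivative_circlepath)
  finally show ?thesis .
qed

lemma continuous_on_slice1:
  assumes "continuous_on (A \<times> B) f" "w \<in> B"
  shows "continuous_on A (\<lambda>z. f (z, w))"
  by (rule continuous_on_compose2[OF assms(1)]) (use assms(2) in \<open>auto intro!: continuous_intros\<close>)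

lemma circlepath_in: "r \<ge> 0 \<Longrightarrow> circlepath z0 r t \<in> sphere z0 r"
  by (simp add: circlepath dist_norm norm_mult)

lemma circlepath_neq: "z \<in> ball z0 r \<Longrightarrow> r > 0 \<Longrightarrow> circlepath z0 r t \<noteq> z"
  using circlepath_in[of r z0 t] by auto

lemma continuous_circlepath: "continuous_on S (circlepath z r)"
  unfolding circlepath by (intro continuous_intros)

lemma pd1_continuous_on:
  assumes A: "open A" and B: "open B" and cont: "continuous_on (A \<times> B) f"
    and hol: "\<And>w. w \<in> B \<Longrightarrow> (\<lambda>z. f (z, w)) holomorphic_on A"
  shows "continuous_on (A \<times> B) (pd1 f)"
proof -
  have "continuous (at (z0, w0)) (pd1 f)" if "z0 \<in> A" "w0 \<in> B" for z0 w0
  proof -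
    obtain r where r: "r > 0" "cball z0 r \<subseteq> A"
      using A \<open>z0 \<in> A\<close> open_contains_cball by blast
    have "continuous_on ((ball z0 r \<times> B) \<times> cbox (0::real) 1)
       (\<lambda>(p, t). f (circlepath z0 r t, snd p) / (circlepath z0 r t - fst p)^2 *
       (2 * of_real pi * \<i> * r * exp (2 * of_real pi * \<i> * t)))"
      unfolding split_beta
    proof (intro continuous_on_mult continuous_on_divide)
      have "sphere z0 r \<subseteq> A" using r by auto
      then have "circlepath z0 r t \<in> A" for t
        using circlepath_in[of r z0 t] r by auto
      then show "continuous_on ((ball z0 r \<times> B) \<times> cbox (0::real) 1)
        (\<lambda>x. f (circlepath z0 r (snd x), snd (fst x)))"
        by (intro continuous_on_compose2[OF cont] continuous_on_Pair continuous_on_fst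
            continuous_on_snd continuous_on_id
            continuous_on_compose2[OF continuous_circlepath[of UNIV]]) auto
      show "\<forall>x \<in> (ball z0 r \<times> B) \<times> cbox (0::real) 1. (circlepath z0 r (snd x) - fst (fst x))\<^sup>2 \<noteq> 0"
        using circlepath_neq[OF _ r(1)] by auto
      show "continuous_on ((ball z0 r \<times> B) \<times> cbox (0::real) 1)
        (\<lambda>x. (circlepath z0 r (snd x) - fst (fst x))\<^sup>2)"
        by (intro continuous_on_power continuous_on_diff continuous_on_fst
            continuous_on_snd continuous_on_id
            continuous_on_compose2[OF continuous_circlepath[of UNIV]]) auto
    qed (intro continuous_intros)+
    from integral_continuous_on_param[OF this]
    have "continuous_on (ball z0 r \<times> B) (\<lambda>p. integral (cbox 0 1)
     (\<lambda>t. f (circlepath z0 r t, snd p) / (circlepath z0 r t - fst p)^2 *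
       (2 * of_real pi * \<i> * r * exp (2 * of_real pi * \<i> * t))) / (2 * of_real pi * \<i>))"
      by (intro continuous_intros) auto
    also have "?this \<longleftrightarrow> continuous_on (ball z0 r \<times> B) (pd1 f)"
    proof (rule continuous_on_cong[OF refl])
      fix p assume p: "p \<in> ball z0 r \<times> B"
      have "continuous_on (cball z0 r) (\<lambda>z. f (z, snd p))"
        by (rule continuous_on_subset[OF continuous_on_slice1[OF cont]]) (use p r in auto)
      moreover have "(\<lambda>z. f (z, snd p)) holomorphic_on ball z0 r"
        by (rule holomorphic_on_subset[OF hol]) (use p r in auto)
      ultimately show "integral (cbox 0 1)
     (\<lambda>t. f (circlepath z0 r t, snd p) / (circlepath z0 r t - fst p)^2 *
       (2 * of_real pi * \<i> * r * exp (2 * of_real pi * \<i> * t))) / (2 * of_real pi * \<i>) = pd1 f p"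
        using pd1_integral[of z0 r f "snd p" "fst p"] p by (auto simp: mem_Times_iff)
    qed
    finally have "continuous_on (ball z0 r \<times> B) (pd1 f)" .
    moreover have "open (ball z0 r \<times> B)" using B by (auto intro: open_Times)
    ultimately show ?thesis
      using r that by (auto simp: continuous_on_eq_continuous_at)
  qed
  then show ?thesis
    by (auto intro!: continuous_at_imp_continuous_on)
qed

lemma pd2_swap: "pd2 f p = pd1 (f \<circ> prod.swap) (prod.swap p)"
  by (simp add: pd1_def pd2_def)

lemma pd2_continuous_on:
  assumes A: "open A" and B: "open B" and cont: "continuous_on (A \<times> B) f"
    and hol: "\<And>z. z \<in> A \<Longrightarrow> (\<lambda>w. f (z, w)) holomorphic_on B"
  shows "continuous_on (A \<times> B) (pd2 f)"
proof -
  have "continuous_on (B \<times> A) (pd1 (f \<circ> prod.swap))"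
    by (rule pd1_continuous_on[OF B A])
      (auto intro!: continuous_on_compose2[OF cont] continuous_on_swap hol simp: o_def)
  then have "continuous_on (A \<times> B) (\<lambda>p. pd1 (f \<circ> prod.swap) (prod.swap p))"
    by (rule continuous_on_compose2) (auto intro!: continuous_on_swap)
  then show ?thesis by (simp add: pd2_swap[abs_def])
qed

lemma separately_holomorphic_imp_complex_diff:
  assumes A: "open A" and B: "open B" "convex B" and cont: "continuous_on (A \<times> B) f"
    and hol1: "\<And>w. w \<in> B \<Longrightarrow> (\<lambda>z. f (z, w)) holomorphic_on A"
    and hol2: "\<And>z. z \<in> A \<Longrightarrow> (\<lambda>w. f (z, w)) holomorphic_on B"
    and p: "p \<in> A \<times> B"
  shows "complex_diff_at f p"
proof -
  obtain z w where zw: "p = (z, w)" "z \<in> A" "w \<in> B" using p by auto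
  have d1: "((\<lambda>x. f (x, w)) has_field_derivative pd1 f (x, w)) (at x)" if "x \<in> A" for x
    using holomorphic_derivI[OF hol1[OF zw(3)] A that] by (simp add: pd1_def)
  have d2: "((\<lambda>y. f (x, y)) has_field_derivative pd2 f (x, y)) (at y)" if "x \<in> A" "y \<in> B" for x y
    using holomorphic_derivI[OF hol2[OF that(1)] B(1) that(2)] by (simp add: pd2_def)
  have c: "continuous_on (A \<times> B) (pd2 f)"
    by (rule pd2_continuous_on[OF A B(1) cont hol2])
  have "((\<lambda>(x, y). f (x, y)) has_derivative
     (\<lambda>(tx, ty). pd1 f (z, w) * tx + blinfun_mult_right (pd2 f (z, w)) ty)) (at (z, w) within A \<times> B)"
  proof (rule has_derivative_partialsI)
    show "((\<lambda>x. f (x, w)) has_derivative (*) (pd1 f (z, w))) (at z within A)"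
      using d1[OF zw(2)] by (auto simp: has_field_derivative_def intro: has_derivative_at_withinI)
    show "((\<lambda>y. f (x, y)) has_derivative blinfun_mult_right (pd2 f (x, y))) (at y within B)"
      if "x \<in> A" "y \<in> B" for x y
      using d2[OF that] by (auto simp: has_field_derivative_def intro: has_derivative_at_withinI)
    have "continuous_on (A \<times> B) (\<lambda>q. blinfun_mult_right (pd2 f q))"
      by (rule bounded_linear.continuous_on[OF bounded_linear_blinfun_mult_right c])
    moreover have "(\<lambda>(x, y). blinfun_mult_right (pd2 f (x, y))) = (\<lambda>q. blinfun_mult_right (pd2 f q))"
      by auto
    ultimately have "continuous_on (A \<times> B) (\<lambda>(x, y). blinfun_mult_right (pd2 f (x, y)))"
      by (simp only:)
    then show "continuous (at (z, w) within A \<times> B) (\<lambda>(x, y). blinfun_mult_right (pd2 f (x, y)))"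
      using p unfolding zw(1) continuous_on_eq_continuous_within by (rule bspec)
  qed (rule zw(3) B(2))+
  moreover have "open (A \<times> B)" using A B by (auto intro: open_Times)
  ultimately have "(f has_derivative (\<lambda>v. pd1 f (z, w) * fst v + pd2 f (z, w) * snd v)) (at (z, w))"
    using at_within_open[OF p[unfolded zw(1)]] by (simp add: split_beta')
  then show ?thesis unfolding complex_diff_at_def zw by blast
qed

lemma pd1_holomorphic_snd:
  assumes A: "open A" and B: "open B" and cont: "continuous_on (A \<times> B) f"
    and hol1: "\<And>w. w \<in> B \<Longrightarrow> (\<lambda>z. f (z, w)) holomorphic_on A"
    and hol2: "\<And>z. z \<in> A \<Longrightarrow> (\<lambda>w. f (z, w)) holomorphic_on B"
    and "convex B"
    and z: "z \<in> A"
  shows "(\<lambda>w. pd1 f (z, w)) holomorphic_on B"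
proof -
  obtain r where r: "r > 0" "cball z r \<subseteq> A"
    using A z open_contains_cball by blast
  have sph: "circlepath z r t \<in> A" for t
    using circlepath_in[of r z t] r by auto
  have neq: "circlepath z r t \<noteq> z" for t
    using circlepath_neq[of z z r t] r by auto
  let ?K = "\<lambda>t. (2 * of_real pi * \<i> * r * exp (2 * of_real pi * \<i> * t)) / (circlepath z r t - z)^2"
  have K: "continuous_on S ?K" for S
    using neq by (auto intro!: continuous_intros continuous_circlepath)
  have c2: "continuous_on (A \<times> B) (pd2 f)"
    by (rule pd2_continuous_on[OF A B cont hol2])
  have "(\<lambda>w. integral (cbox (0::real) 1) (\<lambda>t. f (circlepath z r t, w) * ?K t)) holomorphic_on B"
  proof (rule leibniz_rule_holomorphic)
    fix w t assume "w \<in> B" "t \<in> cbox (0::real) 1"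
    show "((\<lambda>w. f (circlepath z r t, w) * ?K t) has_field_derivative
        pd2 f (circlepath z r t, w) * ?K t) (at w within B)"
      using holomorphic_derivI[OF hol2[OF sph[of t]] B \<open>w \<in> B\<close>]
      by (intro DERIV_cmult_right) (simp add: pd2_def DERIV_subset)
  next
    fix w assume "w \<in> B"
    show "(\<lambda>t. f (circlepath z r t, w) * ?K t) integrable_on cbox (0::real) 1"
      by (rule integrable_continuous, intro continuous_on_mult K continuous_on_compose2[OF cont]
            continuous_on_Pair continuous_circlepath continuous_on_const) (use sph \<open>w \<in> B\<close> in auto)
  next
    show "continuous_on (B \<times> cbox (0::real) 1) (\<lambda>(w, t). pd2 f (circlepath z r t, w) * ?K t)"
      unfolding split_beta
      by (intro continuous_on_mult continuous_on_compose2[OF K[of UNIV]] continuous_on_compose2[OF c2]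
            continuous_on_Pair continuous_on_compose2[OF continuous_circlepath[of UNIV]]
            continuous_on_fst continuous_on_snd continuous_on_id) (use sph in auto)
  qed (use assms in auto)
  then have "(\<lambda>w. integral (cbox (0::real) 1) (\<lambda>t. f (circlepath z r t, w) * ?K t) / (2 * of_real pi * \<i>)) holomorphic_on B"
    by (intro holomorphic_intros) auto
  moreover have "integral (cbox (0::real) 1) (\<lambda>t. f (circlepath z r t, w) * ?K t) / (2 * of_real pi * \<i>)
       = pd1 f (z, w)" if "w \<in> B" for w
  proof -
    have "continuous_on (cball z r) (\<lambda>x. f (x, w))"
      by (rule continuous_on_subset[OF continuous_on_slice1[OF cont that]]) (use r in auto)
    moreover have "(\<lambda>x. f (x, w)) holomorphic_on ball z r"
      by (rule holomorphic_on_subset[OF hol1[OF that]]) (use r in auto)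
    ultimately show ?thesis
      using pd1_integral[of z r f w z] r by simp
  qed
  ultimately show ?thesis
    by (rule holomorphic_transform)
qed

lemma holomorphic_near0_polydisc:
  assumes "holomorphic_near0 f"
  obtains r where "r > 0" "\<And>p. p \<in> ball 0 r \<times> ball 0 r \<Longrightarrow> complex_diff_at f p"
proof -
  obtain S where S: "open S" "0 \<in> S" "\<And>p. p \<in> S \<Longrightarrow> complex_diff_at f p"
    using assms unfolding holomorphic_near0_def eventually_nhds by blast
  then obtain A B where AB: "open A" "open B" "0 \<in> A \<times> B" "A \<times> B \<subseteq> S"
    using open_prod_elim by metis
  then have "0 \<in> A" "0 \<in> B" by (auto simp: zero_prod_def)
  obtain r1 where "r1 > 0" "ball 0 r1 \<subseteq> A"
    using open_contains_ball[of A] \<open>0 \<in> A\<close> AB(1) by blast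
  moreover obtain r2 where "r2 > 0" "ball 0 r2 \<subseteq> B"
    using open_contains_ball[of B] \<open>0 \<in> B\<close> AB(2) by blast
  ultimately have "ball 0 (min r1 r2) \<times> ball 0 (min r1 r2) \<subseteq> S" "min r1 r2 > 0"
    using AB by (auto simp: subset_iff)
  then show thesis using that S by blast
qed

lemma holomorphic_near0I:
  assumes "r > 0" "\<And>p. p \<in> ball 0 r \<times> ball 0 r \<Longrightarrow> complex_diff_at f p"
  shows "holomorphic_near0 f"
proof -
  have "open (ball 0 r \<times> ball 0 r :: C2 set)" "(0::C2) \<in> ball 0 r \<times> ball 0 r"
    using assms by (auto intro: open_Times simp: zero_prod_def)
  then show ?thesis unfolding holomorphic_near0_def eventually_nhds
    by (intro exI[of _ "ball 0 r \<times> ball 0 r"]) (simp add: assms(2))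
qed

lemma complex_diff_at_imp_separately:
  assumes "\<And>p. p \<in> A \<times> B \<Longrightarrow> complex_diff_at f p"
  shows "continuous_on (A \<times> B) f"
    and "w \<in> B \<Longrightarrow> (\<lambda>z. f (z, w)) holomorphic_on A"
    and "z \<in> A \<Longrightarrow> (\<lambda>w. f (z, w)) holomorphic_on B"
proof -
  show "continuous_on (A \<times> B) f"
    using assms unfolding complex_diff_at_def
    by (meson continuous_at_imp_continuous_on has_derivative_continuous)
  show "(\<lambda>z. f (z, w)) holomorphic_on A" if "w \<in> B"
    unfolding holomorphic_on_def
  proof
    fix z assume "z \<in> A"
    then show "(\<lambda>z. f (z, w)) field_differentiable at z within A"
      using assms[of "(z, w)"] that complex_diff_at_partials(1)[of f _ _ "(z, w)"]
      unfolding complex_diff_at_def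
      by (auto simp: field_differentiable_def intro: has_field_derivative_at_within)
  qed
  show "(\<lambda>w. f (z, w)) holomorphic_on B" if "z \<in> A"
    unfolding holomorphic_on_def
  proof
    fix w assume "w \<in> B"
    then show "(\<lambda>w. f (z, w)) field_differentiable at w within B"
      using assms[of "(z, w)"] that complex_diff_at_partials(2)[of f _ _ "(z, w)"]
      unfolding complex_diff_at_def
      by (auto simp: field_differentiable_def intro: has_field_derivative_at_within)
  qed
qed

lemma holomorphic_near0_pd1:
  assumes "holomorphic_near0 f"
  shows "holomorphic_near0 (pd1 f)"
proof -
  obtain r where r: "r > 0" "\<And>p. p \<in> ball 0 r \<times> ball 0 r \<Longrightarrow> complex_diff_at f p"
    using holomorphic_near0_polydisc[OF assms] by blast
  have s: "continuous_on (ball 0 r \<times> ball 0 r) f"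
    "\<And>w. w \<in> ball 0 r \<Longrightarrow> (\<lambda>z. f (z, w)) holomorphic_on ball 0 r"
    "\<And>z. z \<in> ball 0 r \<Longrightarrow> (\<lambda>w. f (z, w)) holomorphic_on ball 0 r"
    using complex_diff_at_imp_separately[of "ball 0 r" "ball 0 r" f] r(2) by blast+
  have "complex_diff_at (pd1 f) p" if "p \<in> ball 0 r \<times> ball 0 r" for p
  proof (rule separately_holomorphic_imp_complex_diff[OF open_ball open_ball convex_ball _ _ _ that])
    show "continuous_on (ball 0 r \<times> ball 0 r) (pd1 f)"
      by (rule pd1_continuous_on[OF open_ball open_ball s(1,2)])
    show "(\<lambda>z. pd1 f (z, w)) holomorphic_on ball 0 r" if "w \<in> ball 0 r" for w
      unfolding pd1_def using holomorphic_deriv[OF s(2)[OF that] open_ball] by simp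
    show "(\<lambda>w. pd1 f (z, w)) holomorphic_on ball 0 r" if "z \<in> ball 0 r" for z
      by (rule pd1_holomorphic_snd[OF open_ball open_ball s convex_ball that])
  qed
  then show ?thesis using holomorphic_near0I[OF r(1)] by blast
qed

lemma eventually_swap_nhds0:
  assumes "\<forall>\<^sub>F p in nhds (0::C2). P p"
  shows "\<forall>\<^sub>F p in nhds (0::C2). P (prod.swap p)"
proof -
  have "(\<lambda>p::C2. (snd p, fst p)) \<midarrow>0\<rightarrow> (snd (0::C2), fst (0::C2))"
    by (rule tendsto_Pair[OF tendsto_snd[OF tendsto_ident_at] tendsto_fst[OF tendsto_ident_at]])
  then have "filterlim prod.swap (nhds (prod.swap (0::C2))) (nhds (0::C2))"
    using tendsto_at_iff_tendsto_nhds[of "prod.swap :: C2 \<Rightarrow> C2" 0] unfolding prod.swap_def by (rule iffD1[rotated])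
  moreover have "prod.swap (0::C2) = 0"
    by (simp add: prod_eq_iff)
  ultimately have "filterlim prod.swap (nhds (0::C2)) (nhds (0::C2))"
    by simp
  from eventually_compose_filterlim[OF assms this] show ?thesis .
qed

lemma complex_diff_at_swap:
  assumes "complex_diff_at f (prod.swap p)"
  shows "complex_diff_at (f \<circ> prod.swap) p"
proof -
  obtain a b where f: "(f has_derivative (\<lambda>v. a * fst v + b * snd v)) (at (prod.swap p))"
    using assms unfolding complex_diff_at_def by blast
  have "(prod.swap has_derivative prod.swap) (at p)"
    unfolding prod.swap_def by (intro derivative_intros)
  from has_derivative_compose[OF this f] show ?thesis
    unfolding complex_diff_at_def
    by (intro exI[of _ b] exI[of _ a]) (simp add: o_def add.commute)
qed

lemma holomorphic_near0_swap: "holomorphic_near0 f \<Longrightarrow> holomorphic_near0 (f \<circ> prod.swap)"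
  unfolding holomorphic_near0_def
  by (drule eventually_swap_nhds0) (erule eventually_mono, rule complex_diff_at_swap)

lemma holomorphic_near0_pd2:
  assumes "holomorphic_near0 f"
  shows "holomorphic_near0 (pd2 f)"
proof -
  have "pd2 f = pd1 (f \<circ> prod.swap) \<circ> prod.swap"
    by (auto simp: pd2_swap)
  then show ?thesis
    by (simp add: assms holomorphic_near0_pd1 holomorphic_near0_swap)
qed

lemma complex_diff_at_const: "complex_diff_at (\<lambda>_. c) p"
  unfolding complex_diff_at_def by (rule exI[of _ 0], rule exI[of _ 0]) simp

lemma complex_diff_at_add: "complex_diff_at f p \<Longrightarrow> complex_diff_at g p \<Longrightarrow> complex_diff_at (\<lambda>q. f q + g q) p"
  and complex_diff_at_diff: "complex_diff_at f p \<Longrightarrow> complex_diff_at g p \<Longrightarrow> complex_diff_at (\<lambda>q. f q - g q) p"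
  and complex_diff_at_mult: "complex_diff_at f p \<Longrightarrow> complex_diff_at g p \<Longrightarrow> complex_diff_at (\<lambda>q. f q * g q) p"
proof -
  assume "complex_diff_at f p" "complex_diff_at g p"
  then obtain a b c d where
    f: "(f has_derivative (\<lambda>v. a * fst v + b * snd v)) (at p)" and
    g: "(g has_derivative (\<lambda>v. c * fst v + d * snd v)) (at p)"
    unfolding complex_diff_at_def by blast
  show "complex_diff_at (\<lambda>q. f q + g q) p"
    unfolding complex_diff_at_def
    using has_derivative_add[OF f g]
    by (intro exI[of _ "a + c"] exI[of _ "b + d"]) (simp add: algebra_simps)
  show "complex_diff_at (\<lambda>q. f q - g q) p"
    unfolding complex_diff_at_def
    using has_derivative_diff[OF f g]
    by (intro exI[of _ "a - c"] exI[of _ "b - d"]) (simp add: algebra_simps)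
  show "complex_diff_at (\<lambda>q. f q * g q) p"
    unfolding complex_diff_at_def
    using has_derivative_mult[OF f g]
    by (intro exI[of _ "f p * c + a * g p"] exI[of _ "f p * d + b * g p"]) (simp add: algebra_simps)
qed

lemma holomorphic_near0_const: "holomorphic_near0 (\<lambda>_. c)"
  by (simp add: holomorphic_near0_def complex_diff_at_const)

lemma holomorphic_near0_add: "holomorphic_near0 f \<Longrightarrow> holomorphic_near0 g \<Longrightarrow> holomorphic_near0 (\<lambda>p. f p + g p)"
  and holomorphic_near0_diff: "holomorphic_near0 f \<Longrightarrow> holomorphic_near0 g \<Longrightarrow> holomorphic_near0 (\<lambda>p. f p - g p)"
  and holomorphic_near0_mult: "holomorphic_near0 f \<Longrightarrow> holomorphic_near0 g \<Longrightarrow> holomorphic_near0 (\<lambda>p. f p * g p)"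
proof -
  assume "holomorphic_near0 f" "holomorphic_near0 g"
  then have *: "\<forall>\<^sub>F p in nhds 0. complex_diff_at f p \<and> complex_diff_at g p"
    by (simp add: holomorphic_near0_def eventually_conj)
  show "holomorphic_near0 (\<lambda>p. f p + g p)"
    unfolding holomorphic_near0_def
    by (rule eventually_mono[OF *]) (simp add: complex_diff_at_add)
  show "holomorphic_near0 (\<lambda>p. f p - g p)"
    unfolding holomorphic_near0_def
    by (rule eventually_mono[OF *]) (simp add: complex_diff_at_diff)
  show "holomorphic_near0 (\<lambda>p. f p * g p)"
    unfolding holomorphic_near0_def
    by (rule eventually_mono[OF *]) (simp add: complex_diff_at_mult)
qed

section \<open>Germs of holomorphic functions, vector fields and forms\<close>

quotient_type germ = "C2 \<Rightarrow> complex" / partial: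
  "\<lambda>f g. holomorphic_near0 f \<and> holomorphic_near0 g \<and> (\<forall>\<^sub>F p in nhds 0. f p = g p)"
proof (rule part_equivpI)
  show "\<exists>f. holomorphic_near0 f \<and> holomorphic_near0 f \<and> (\<forall>\<^sub>F p in nhds 0. f p = f p)"
    using holomorphic_near0_const by auto
  show "symp (\<lambda>f g. holomorphic_near0 f \<and> holomorphic_near0 g \<and> (\<forall>\<^sub>F p in nhds 0. f p = g p))"
    by (auto intro!: sympI simp: eq_commute)
  show "transp (\<lambda>f g. holomorphic_near0 f \<and> holomorphic_near0 g \<and> (\<forall>\<^sub>F p in nhds 0. f p = g p))"
  proof (rule transpI, intro conjI)
    fix f g h :: "C2 \<Rightarrow> complex"
    assume fg: "holomorphic_near0 f \<and> holomorphic_near0 g \<and> (\<forall>\<^sub>F p in nhds 0. f p = g p)"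
      and gh: "holomorphic_near0 g \<and> holomorphic_near0 h \<and> (\<forall>\<^sub>F p in nhds 0. g p = h p)"
    show "holomorphic_near0 f" "holomorphic_near0 h" using fg gh by simp_all
    have "\<forall>\<^sub>F p in nhds 0. f p = g p" "\<forall>\<^sub>F p in nhds 0. g p = h p" using fg gh by simp_all
    then show "\<forall>\<^sub>F p in nhds 0. f p = h p" by eventually_elim simp
  qed
qed

lemma pd_cong_near0:
  assumes "\<forall>\<^sub>F p in nhds (0::C2). f p = g p"
  shows "\<forall>\<^sub>F p in nhds 0. pd1 f p = pd1 g p \<and> pd2 f p = pd2 g p"
proof -
  have "\<forall>\<^sub>F p in nhds 0. \<forall>\<^sub>F q in nhds p. f q = g q"
    using assms by (simp add: eventually_eventually)
  then show ?thesis
  proof (rule eventually_mono)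
    fix p assume ev: "\<forall>\<^sub>F q in nhds p. f q = g q"
    have 1: "filterlim (\<lambda>x. (x, snd p)) (nhds (fst p, snd p)) (nhds (fst p))"
      by (intro tendsto_Pair tendsto_const filterlim_ident)
    have 2: "filterlim (\<lambda>y. (fst p, y)) (nhds (fst p, snd p)) (nhds (snd p))"
      by (intro tendsto_Pair tendsto_const filterlim_ident)
    have "\<forall>\<^sub>F x in nhds (fst p). f (x, snd p) = g (x, snd p)"
      using eventually_compose_filterlim[OF _ 1] ev by simp
    moreover have "\<forall>\<^sub>F y in nhds (snd p). f (fst p, y) = g (fst p, y)"
      using eventually_compose_filterlim[OF _ 2] ev by simp
    ultimately show "pd1 f p = pd1 g p \<and> pd2 f p = pd2 g p"
      by (simp add: pd1_def pd2_def deriv_cong_ev)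
  qed
qed

instantiation germ :: comm_ring_1
begin

lift_definition zero_germ :: germ is "\<lambda>_. 0"
  by (simp add: holomorphic_near0_const)

lift_definition one_germ :: germ is "\<lambda>_. 1"
  by (simp add: holomorphic_near0_const)

lift_definition plus_germ :: "germ \<Rightarrow> germ \<Rightarrow> germ" is "\<lambda>f g p. f p + g p"
  by (auto intro: holomorphic_near0_add elim: eventually_elim2)

lift_definition minus_germ :: "germ \<Rightarrow> germ \<Rightarrow> germ" is "\<lambda>f g p. f p - g p"
  by (auto intro: holomorphic_near0_diff elim: eventually_elim2)

lift_definition times_germ :: "germ \<Rightarrow> germ \<Rightarrow> germ" is "\<lambda>f g p. f p * g p"
  by (auto intro: holomorphic_near0_mult elim: eventually_elim2)

lift_definition uminus_germ :: "germ \<Rightarrow> germ" is "\<lambda>f p. - f p"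
  using holomorphic_near0_diff[OF holomorphic_near0_const[of 0]] by (auto elim: eventually_mono)

instance
proof
  fix a b c :: germ
  show "a + b + c = a + (b + c)"
    by transfer (auto intro!: holomorphic_near0_add simp: add.assoc)
  show "a + b = b + a"
    by transfer (auto intro!: holomorphic_near0_add simp: add.commute)
  show "0 + a = a"
    by transfer (auto intro!: holomorphic_near0_add)
  show "- a + a = 0"
    by transfer (auto simp: holomorphic_near0_const)
  show "a - b = a + - b"
    by transfer (auto intro!: holomorphic_near0_diff)
  show "a * b * c = a * (b * c)"
    by transfer (auto intro!: holomorphic_near0_mult simp: mult.assoc)
  show "a * b = b * a"
    by transfer (auto intro!: holomorphic_near0_mult simp: mult.commute)
  show "1 * a = a"
    by transfer (auto intro!: holomorphic_near0_mult)
  show "(a + b) * c = a * c + b * c"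
    by transfer (auto intro!: holomorphic_near0_add holomorphic_near0_mult simp: distrib_right)
  show "(0::germ) \<noteq> 1"
    by transfer auto
qed

end

lift_definition germ_const :: "complex \<Rightarrow> germ" is "\<lambda>c _. c"
  by (simp add: holomorphic_near0_const)

lift_definition val0 :: "germ \<Rightarrow> complex" is "\<lambda>f. f 0"
  by (auto dest: eventually_nhds_x_imp_x)

lift_definition D1 :: "germ \<Rightarrow> germ" is pd1
  by (auto intro: holomorphic_near0_pd1 eventually_mono[OF pd_cong_near0])

lift_definition D2 :: "germ \<Rightarrow> germ" is pd2
  by (auto intro: holomorphic_near0_pd2 eventually_mono[OF pd_cong_near0])

lemma germ_const_simps [simp]:
  "germ_const 0 = 0" "germ_const 1 = 1"
  "germ_const (a + b) = germ_const a + germ_const b"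
  "germ_const (a * b) = germ_const a * germ_const b"
  by (transfer, simp add: holomorphic_near0_const)+

lemma val0_simps [simp]:
  "val0 0 = 0" "val0 1 = 1" "val0 (germ_const c) = c"
  "val0 (a + b) = val0 a + val0 b" "val0 (a - b) = val0 a - val0 b"
  "val0 (- a) = - val0 a" "val0 (a * b) = val0 a * val0 b"
  by (transfer; simp)+

lemma pd_mult_add:
  assumes "complex_diff_at f p" "complex_diff_at g p"
  shows "pd1 (\<lambda>p. f p * g p) p = pd1 f p * g p + f p * pd1 g p"
    and "pd2 (\<lambda>p. f p * g p) p = pd2 f p * g p + f p * pd2 g p"
    and "pd1 (\<lambda>p. f p + g p) p = pd1 f p + pd1 g p"
    and "pd2 (\<lambda>p. f p + g p) p = pd2 f p + pd2 g p"
proof -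
  obtain a b c d where
    f: "(f has_derivative (\<lambda>v. a * fst v + b * snd v)) (at p)" and
    g: "(g has_derivative (\<lambda>v. c * fst v + d * snd v)) (at p)"
    using assms unfolding complex_diff_at_def by blast
  have m: "((\<lambda>q. f q * g q) has_derivative
      (\<lambda>v. (f p * c + a * g p) * fst v + (f p * d + b * g p) * snd v)) (at p)"
    using has_derivative_mult[OF f g] by (simp add: algebra_simps)
  have s: "((\<lambda>q. f q + g q) has_derivative (\<lambda>v. (a + c) * fst v + (b + d) * snd v)) (at p)"
    using has_derivative_add[OF f g] by (simp add: algebra_simps)
  note pd = complex_diff_at_partials(3,4)[OF f] complex_diff_at_partials(3,4)[OF g]
      complex_diff_at_partials(3,4)[OF m] complex_diff_at_partials(3,4)[OF s]
  show "pd1 (\<lambda>p. f p * g p) p = pd1 f p * g p + f p * pd1 g p"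
    and "pd2 (\<lambda>p. f p * g p) p = pd2 f p * g p + f p * pd2 g p"
    and "pd1 (\<lambda>p. f p + g p) p = pd1 f p + pd1 g p"
    and "pd2 (\<lambda>p. f p + g p) p = pd2 f p + pd2 g p"
    by (simp_all add: pd)
qed

lemma eventually_complex_diff_at2:
  assumes "holomorphic_near0 f" "holomorphic_near0 g"
    and "\<And>p. complex_diff_at f p \<Longrightarrow> complex_diff_at g p \<Longrightarrow> P p"
  shows "\<forall>\<^sub>F p in nhds 0. P p"
  using assms(1,2) unfolding holomorphic_near0_def
  by (rule eventually_elim2) (rule assms(3))

lemmas holomorphic_near0_intros = holomorphic_near0_pd1 holomorphic_near0_pd2
  holomorphic_near0_add holomorphic_near0_diff holomorphic_near0_mult

lemma D_mult:
  "D1 (a * b) = D1 a * b + a * D1 b" "D2 (a * b) = D2 a * b + a * D2 b"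
  by (transfer; simp add: holomorphic_near0_intros eventually_complex_diff_at2 pd_mult_add)+

lemma D_add:
  "D1 (a + b) = D1 a + D1 b" "D2 (a + b) = D2 a + D2 b"
  by (transfer; simp add: holomorphic_near0_intros eventually_complex_diff_at2 pd_mult_add)+

lemma germ_unit_cancel:
  assumes "val0 u \<noteq> 0" "u * a = 0"
  shows "a = 0"
  using assms
proof (transfer, clarify)
  fix u a :: "C2 \<Rightarrow> complex"
  assume u: "holomorphic_near0 u" "u 0 \<noteq> 0" and ev: "\<forall>\<^sub>F p in nhds 0. u p * a p = 0"
  have "complex_diff_at u 0"
    using u(1) by (simp add: holomorphic_near0_def eventually_nhds_x_imp_x)
  then have "isCont u 0"
    unfolding complex_diff_at_def by (auto dest: has_derivative_continuous)
  then have "(u \<longlongrightarrow> u 0) (nhds 0)"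
    by (simp add: isCont_def tendsto_at_iff_tendsto_nhds)
  from tendsto_imp_eventually_ne[OF this u(2)] ev
  show "\<forall>\<^sub>F p in nhds 0. a p = 0"
    by eventually_elim auto
qed

text \<open>
  The pair (a, b) stands for the 1-form a dx + b dy, respectively for the vector field
  a \<partial>/\<partial>x + b \<partial>/\<partial>y; the germ c stands for the 2-form
  c dx \<and> dy.
\<close>

type_synonym one_form = "germ \<times> germ"
type_synonym vector_field = "germ \<times> germ"
type_synonym two_form = germ

definition wedge :: "one_form \<Rightarrow> one_form \<Rightarrow> two_form" where
  "wedge \<omega> \<eta> = fst \<omega> * snd \<eta> - snd \<omega> * fst \<eta>"

definition ext_d0 :: "germ \<Rightarrow> one_form" where
  "ext_d0 f = (D1 f, D2 f)"

definition ext_d1 :: "one_form \<Rightarrow> two_form" where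
  "ext_d1 \<omega> = D1 (snd \<omega>) - D2 (fst \<omega>)"

definition contract1 :: "vector_field \<Rightarrow> one_form \<Rightarrow> germ" where
  "contract1 X \<omega> = fst \<omega> * fst X + snd \<omega> * snd X"

definition contract2 :: "vector_field \<Rightarrow> two_form \<Rightarrow> one_form" where
  "contract2 X c = (- c * snd X, c * fst X)"

definition lie_deriv :: "vector_field \<Rightarrow> one_form \<Rightarrow> one_form" where
  "lie_deriv X \<omega> = contract2 X (ext_d1 \<omega>) + ext_d0 (contract1 X \<omega>)"

definition at0 :: "germ \<times> germ \<Rightarrow> C2" where
  "at0 \<omega> = (val0 (fst \<omega>), val0 (snd \<omega>))"

section \<open>Foliations and webs\<close>

text \<open>
  A smooth foliation germ is a 1-form germ without zero at the origin, taken up to having the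
  same kernel at all points near the origin, i.e. up to multiplication by a unit of the ring of
  germs. All notions below are lifted from a defining form and so do not depend on its choice.
\<close>

lemma unit_multiple_of_wedge_zero:
  assumes "wedge \<omega> \<eta> = 0" "at0 \<omega> \<noteq> 0" "at0 \<eta> \<noteq> 0"
  obtains u v where "val0 u \<noteq> 0" "val0 v \<noteq> 0"
    "u * fst \<omega> = v * fst \<eta>" "u * snd \<omega> = v * snd \<eta>"
proof -
  have eq: "fst \<omega> * snd \<eta> = snd \<omega> * fst \<eta>"
    using assms(1) by (simp add: wedge_def)
  from arg_cong[OF this, of val0]
  have v: "val0 (fst \<omega>) * val0 (snd \<eta>) = val0 (snd \<omega>) * val0 (fst \<eta>)" by simp
  show thesis
  proof (cases "val0 (fst \<omega>) = 0")
    case True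
    then have "val0 (snd \<omega>) \<noteq> 0" "val0 (snd \<eta>) \<noteq> 0"
      using v assms(2,3) by (auto simp: at0_def zero_prod_def)
    then show thesis
      using that[of "snd \<eta>" "snd \<omega>"] eq by (simp add: mult.commute)
  next
    case False
    then have "val0 (fst \<eta>) \<noteq> 0"
      using v assms(2,3) by (auto simp: at0_def zero_prod_def)
    then show thesis
      using that[of "fst \<eta>" "fst \<omega>"] eq False by (simp add: mult.commute)
  qed
qed

lemma wedge_zero_trans:
  assumes "wedge \<zeta> \<omega> = 0" "wedge \<omega> \<eta> = 0" "at0 \<omega> \<noteq> 0"
  shows "wedge \<zeta> \<eta> = 0"
proof -
  have e: "fst \<zeta> * snd \<omega> = snd \<zeta> * fst \<omega>" "fst \<omega> * snd \<eta> = snd \<omega> * fst \<eta>"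
    using assms(1,2) by (simp_all add: wedge_def)
  have "fst \<omega> * wedge \<zeta> \<eta> = 0"
  proof -
    have "fst \<omega> * wedge \<zeta> \<eta> = fst \<zeta> * (fst \<omega> * snd \<eta>) - (snd \<zeta> * fst \<omega>) * fst \<eta>"
      by (simp add: wedge_def algebra_simps)
    also have "\<dots> = 0" by (simp only: e(2) e(1)[symmetric]) (simp add: algebra_simps)
    finally show ?thesis .
  qed
  moreover have "snd \<omega> * wedge \<zeta> \<eta> = 0"
  proof -
    have "snd \<omega> * wedge \<zeta> \<eta> = (fst \<zeta> * snd \<omega>) * snd \<eta> - snd \<zeta> * (snd \<omega> * fst \<eta>)"
      by (simp add: wedge_def algebra_simps)
    also have "\<dots> = 0" by (simp only: e(1) e(2)[symmetric]) (simp add: algebra_simps)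
    finally show ?thesis .
  qed
  ultimately show ?thesis
    using assms(3) germ_unit_cancel by (auto simp: at0_def zero_prod_def)
qed

lemma wedge_commute_zero: "wedge \<omega> \<eta> = 0 \<Longrightarrow> wedge \<eta> \<omega> = 0"
  by (simp add: wedge_def algebra_simps)

lemma wedge_lie_deriv_scale:
  "wedge (lie_deriv X (u * fst \<omega>, u * snd \<omega>)) (u * fst \<omega>, u * snd \<omega>)
     = u * u * wedge (lie_deriv X \<omega>) \<omega>"
  by (simp add: wedge_def lie_deriv_def contract1_def contract2_def ext_d0_def ext_d1_def
      D_mult D_add algebra_simps)

quotient_type foliation = one_form / partial:
  "\<lambda>\<omega> \<eta>. at0 \<omega> \<noteq> 0 \<and> at0 \<eta> \<noteq> 0 \<and> wedge \<omega> \<eta> = 0"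
proof (rule part_equivpI)
  show "\<exists>\<omega>. at0 \<omega> \<noteq> 0 \<and> at0 \<omega> \<noteq> 0 \<and> wedge \<omega> \<omega> = 0"
    by (rule exI[of _ "(1, 0)"]) (simp add: at0_def wedge_def zero_prod_def)
  show "symp (\<lambda>\<omega> \<eta>. at0 \<omega> \<noteq> 0 \<and> at0 \<eta> \<noteq> 0 \<and> wedge \<omega> \<eta> = 0)"
    by (rule sympI) (blast intro: wedge_commute_zero)
  show "transp (\<lambda>\<omega> \<eta>. at0 \<omega> \<noteq> 0 \<and> at0 \<eta> \<noteq> 0 \<and> wedge \<omega> \<eta> = 0)"
    by (rule transpI) (blast intro: wedge_zero_trans)
qed

lift_definition tangent_space0 :: "foliation \<Rightarrow> C2 set" is
  "\<lambda>\<omega>. {v. val0 (fst \<omega>) * fst v + val0 (snd \<omega>) * snd v = 0}"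
proof (clarify)
  fix a b c d :: germ
  assume "at0 (a, b) \<noteq> 0" "at0 (c, d) \<noteq> 0" "wedge (a, b) (c, d) = 0"
  then obtain u v where uv: "val0 u \<noteq> 0" "val0 v \<noteq> 0" "u * a = v * c" "u * b = v * d"
    using unit_multiple_of_wedge_zero[of "(a, b)" "(c, d)"] by auto
  have e: "val0 u * val0 a = val0 v * val0 c" "val0 u * val0 b = val0 v * val0 d"
    using arg_cong[OF uv(3), of val0] arg_cong[OF uv(4), of val0] by simp_all
  have "val0 u * (val0 a * x + val0 b * y) = val0 v * (val0 c * x + val0 d * y)" for x y
    using e by (simp add: algebra_simps)
  then have "val0 a * x + val0 b * y = 0 \<longleftrightarrow> val0 c * x + val0 d * y = 0" for x y
    using uv(1,2) by (metis mult_eq_0_iff)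
  then show "{v. val0 (fst (a, b)) * fst v + val0 (snd (a, b)) * snd v = 0} =
     {v. val0 (fst (c, d)) * fst v + val0 (snd (c, d)) * snd v = 0}" by simp
qed

lift_definition vanishes_on_leaves :: "one_form \<Rightarrow> foliation \<Rightarrow> bool" is
  "\<lambda>\<eta> \<omega>. wedge \<eta> \<omega> = 0"
proof (elim conjE, rule iffI)
  fix \<eta> \<omega> \<omega>' :: one_form
  assume h: "at0 \<omega> \<noteq> 0" "at0 \<omega>' \<noteq> 0" "wedge \<omega> \<omega>' = 0"
  show "wedge \<eta> \<omega>' = 0" if "wedge \<eta> \<omega> = 0"
    by (rule wedge_zero_trans[OF that h(3,1)])
  show "wedge \<eta> \<omega> = 0" if "wedge \<eta> \<omega>' = 0"
    by (rule wedge_zero_trans[OF that wedge_commute_zero[OF h(3)] h(2)])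
qed

lift_definition preserves :: "vector_field \<Rightarrow> foliation \<Rightarrow> bool" is
  "\<lambda>X \<omega>. wedge (lie_deriv X \<omega>) \<omega> = 0"
proof (clarify)
  fix X :: vector_field and a b c d :: germ
  assume "at0 (a, b) \<noteq> 0" "at0 (c, d) \<noteq> 0" "wedge (a, b) (c, d) = 0"
  then obtain u v where uv: "val0 u \<noteq> 0" "val0 v \<noteq> 0" "u * a = v * c" "u * b = v * d"
    using unit_multiple_of_wedge_zero[of "(a, b)" "(c, d)"] by auto
  have "u * u * wedge (lie_deriv X (a, b)) (a, b) = v * v * wedge (lie_deriv X (c, d)) (c, d)"
    using wedge_lie_deriv_scale[of X u "(a, b)"] wedge_lie_deriv_scale[of X v "(c, d)"] uv
    by simp
  moreover have "val0 (u * u) \<noteq> 0" "val0 (v * v) \<noteq> 0"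
    using uv(1,2) by simp_all
  ultimately show "wedge (lie_deriv X (a, b)) (a, b) = 0 \<longleftrightarrow> wedge (lie_deriv X (c, d)) (c, d) = 0"
    by (metis germ_unit_cancel mult_zero_right)
qed

text \<open>
  A k-web is the list of its foliations, with W @ [F] for the superposition of W and F.
\<close>

definition regular_web :: "foliation list \<Rightarrow> bool" where
  "regular_web W \<longleftrightarrow> distinct (map tangent_space0 W)"

definition transverse_inf_automorphism :: "vector_field \<Rightarrow> foliation list \<Rightarrow> bool" where
  "transverse_inf_automorphism X W \<longleftrightarrow>
     at0 X \<noteq> 0 \<and> (\<forall>F\<in>set W. preserves X F \<and> at0 X \<notin> tangent_space0 F)"

text \<open>
  For X nonvanishing at the origin dx \<and> dy contracted with X defines the foliation by the
  orbits of X; if X vanishes there, the value is unspecified.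
\<close>

definition foliation_of :: "vector_field \<Rightarrow> foliation" where
  "foliation_of X = abs_foliation (contract2 X 1)"

lemma foliation_of_eqI:
  assumes "at0 X \<noteq> 0" "at0 \<omega> \<noteq> 0" "contract1 X \<omega> = 0"
  shows "abs_foliation \<omega> = foliation_of X"
  unfolding foliation_of_def
  by (rule Quotient_rel_abs[OF Quotient_foliation])
    (use assms in \<open>auto simp: at0_def contract1_def contract2_def wedge_def zero_prod_def\<close>)

text \<open>Tuples indexed by the members of the web are extended by 0 to all of nat.\<close>

definition abelian_relations :: "foliation list \<Rightarrow> (nat \<Rightarrow> one_form) set" where
  "abelian_relations W =
     {\<eta>. (\<forall>i<length W. ext_d1 (\<eta> i) = 0 \<and> vanishes_on_leaves (\<eta> i) (W ! i))
        \<and> (\<forall>i\<ge>length W. \<eta> i = 0)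
        \<and> (\<Sum>i<length W. \<eta> i) = 0}"

definition tuple_scale :: "complex \<Rightarrow> (nat \<Rightarrow> one_form) \<Rightarrow> nat \<Rightarrow> one_form" where
  "tuple_scale c \<eta> i = (germ_const c * fst (\<eta> i), germ_const c * snd (\<eta> i))"

interpretation tuples: vector_space tuple_scale
  by standard (auto simp: tuple_scale_def fun_eq_iff prod_eq_iff algebra_simps)

text \<open>
  The library dimension of an infinite-dimensional space is 0; for regular webs the space of
  abelian relations is finite-dimensional by Bol's bound, so this case does not arise.
\<close>

definition web_rank :: "foliation list \<Rightarrow> nat" where
  "web_rank W = tuples.dim (abelian_relations W)"

text \<open>
  The product is always even, and truncated subtraction gives the correct value 0 for a 1-web.
\<close>

definition maximal_rank :: "foliation list \<Rightarrow> bool" where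
  "maximal_rank W \<longleftrightarrow> web_rank W = (length W - 1) * (length W - 2) div 2"

end

theory Submission
  imports Defs
begin

text \<open>
  Let W consist of k foliations. Since X preserves the i-th foliation and is transverse to it, that
  foliation is defined by a unique form \<open>\<theta>\<^sub>i\<close> with \<open>\<theta>\<^sub>i(X) = 1\<close>, and this form is closed
  (\<open>preserved_foliation_normal_form\<close>).

  The Lie derivative along X acts componentwise on abelian relations. It kills the component
  along the orbits of X, because that component is closed and contracts with X to 0. So it maps the
  abelian relations of the extended web to those of W (\<open>tuple_lie_deriv_maps\<close>). This map is onto: an
  abelian relation of W has components \<open>dg\<^sub>i\<close> by the Poincare lemma, the \<open>g\<^sub>i\<close> can be
  chosen with sum 0, and the forms \<open>g\<^sub>i \<theta>\<^sub>i\<close>, completed by minus their sum, are a preimage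
  (\<open>tuple_lie_deriv_onto\<close>). The kernel consists of the tuples \<open>c\<^sub>i \<theta>\<^sub>i\<close> with constants
  \<open>c\<^sub>i\<close> of sum 0, again completed by minus their sum, and has dimension k - 1 (\<open>dim_kernel\<close>).
  Rank-nullity gives the formula, and the equivalence follows because the Bol bounds of the two webs
  also differ by k - 1.

  Rank-nullity needs the abelian relations of W to form a finite-dimensional space
  (\<open>abelian_relations_finite_dim\<close>). The coefficients \<open>h\<^sub>i = \<eta>\<^sub>i(X)\<close> of a relation sum to 0, and each
  \<open>h\<^sub>i\<close> is constant on the leaves of the i-th foliation. Differentiating the sum along the leaves of all
  foliations but one expresses the derivative \<open>X\<^sup>k\<^sup>-\<^sup>1 h\<^sub>i\<close> linearly in the lower ones
  (\<open>jet_ideal_stationary\<close>). The ideal of germs generated by the lower derivatives is therefore closed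
  under all derivations, and by the identity theorem (\<open>D_closed_vanishing_imp_zero\<close>) the relation is 0 as
  soon as finitely many derivatives vanish at the origin.
\<close>

section \<open>Holomorphic functions on polydiscs\<close>

lemma pd1_complex_diff_on:
  assumes A: "open A" and B: "open B" "convex B"
    and f: "\<And>p. p \<in> A \<times> B \<Longrightarrow> complex_diff_at f p" and p: "p \<in> A \<times> B"
  shows "complex_diff_at (pd1 f) p"
proof -
  have s: "continuous_on (A \<times> B) f"
    "\<And>w. w \<in> B \<Longrightarrow> (\<lambda>z. f (z, w)) holomorphic_on A"
    "\<And>z. z \<in> A \<Longrightarrow> (\<lambda>w. f (z, w)) holomorphic_on B"
    using complex_diff_at_imp_separately[of A B f] f by blast+
  show ?thesis
  proof (rule separately_holomorphic_imp_complex_diff[OF A B _ _ _ p])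
    show "continuous_on (A \<times> B) (pd1 f)"
      by (rule pd1_continuous_on[OF A B(1) s(1,2)])
    show "(\<lambda>z. pd1 f (z, w)) holomorphic_on A" if "w \<in> B" for w
      unfolding pd1_def using holomorphic_deriv[OF s(2)[OF that] A] by simp
    show "(\<lambda>w. pd1 f (z, w)) holomorphic_on B" if "z \<in> A" for z
      by (rule pd1_holomorphic_snd[OF A B(1) s B(2) that])
  qed
qed

lemma pd2_complex_diff_on:
  assumes A: "open A" "convex A" and B: "open B"
    and f: "\<And>p. p \<in> A \<times> B \<Longrightarrow> complex_diff_at f p" and p: "p \<in> A \<times> B"
  shows "complex_diff_at (pd2 f) p"
proof -
  have "complex_diff_at (pd1 (f \<circ> prod.swap)) (prod.swap p)"
    by (rule pd1_complex_diff_on[OF B A])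
      (use p in \<open>auto intro!: complex_diff_at_swap f\<close>)
  from complex_diff_at_swap[OF this] show ?thesis
    by (simp add: pd2_swap[abs_def] o_def)
qed

text \<open>
  Cauchy's formula writes \<open>pd1 f\<close> as a circle integral of \<open>f\<close> against a kernel that does not
  involve the second variable, so \<open>pd2\<close> passes under the integral.
\<close>

lemma pd_commute_on:
  assumes A: "open A" "convex A" and B: "open B" "convex B"
    and f: "\<And>p. p \<in> A \<times> B \<Longrightarrow> complex_diff_at f p" and p: "p \<in> A \<times> B"
  shows "pd2 (pd1 f) p = pd1 (pd2 f) p"
proof -
  obtain z w where zw: "p = (z, w)" "z \<in> A" "w \<in> B" using p by auto
  have s: "continuous_on (A \<times> B) f"
    "\<And>w. w \<in> B \<Longrightarrow> (\<lambda>z. f (z, w)) holomorphic_on A"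
    "\<And>z. z \<in> A \<Longrightarrow> (\<lambda>w. f (z, w)) holomorphic_on B"
    using complex_diff_at_imp_separately[of A B f] f by blast+
  have "\<And>p. p \<in> A \<times> B \<Longrightarrow> complex_diff_at (pd2 f) p"
    by (rule pd2_complex_diff_on[OF A B(1) f])
  then have s2: "continuous_on (A \<times> B) (pd2 f)"
    "\<And>w. w \<in> B \<Longrightarrow> (\<lambda>z. pd2 f (z, w)) holomorphic_on A"
    using complex_diff_at_imp_separately[of A B "pd2 f"] by blast+
  obtain r where r: "r > 0" "cball z r \<subseteq> A"
    using A zw(2) open_contains_cball by blast
  have sph: "circlepath z r t \<in> A" for t
    using circlepath_in[of r z t] r by auto
  have neq: "circlepath z r t \<noteq> z" for t
    using circlepath_neq[of z z r t] r by auto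
  let ?K = "\<lambda>t. (2 * of_real pi * \<i> * r * exp (2 * of_real pi * \<i> * t)) / (circlepath z r t - z)^2"
  have K: "continuous_on S ?K" for S
    using neq by (auto intro!: continuous_intros continuous_circlepath)
  have cauchy: "pd1 g (z, w) = integral (cbox (0::real) 1) (\<lambda>t. g (circlepath z r t, w) * ?K t) / (2 * of_real pi * \<i>)"
    if "continuous_on (A \<times> B) g" "\<And>w. w \<in> B \<Longrightarrow> (\<lambda>z. g (z, w)) holomorphic_on A" "w \<in> B" for g w
  proof -
    have "continuous_on (cball z r) (\<lambda>x. g (x, w))"
      by (rule continuous_on_subset[OF continuous_on_slice1[OF that(1,3)]]) (use r in auto)
    moreover have "(\<lambda>x. g (x, w)) holomorphic_on ball z r"
      by (rule holomorphic_on_subset[OF that(2)[OF that(3)]]) (use r in auto)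
    ultimately show ?thesis
      using pd1_integral[of z r g w z] r by simp
  qed
  have "((\<lambda>w. integral (cbox (0::real) 1) (\<lambda>t. f (circlepath z r t, w) * ?K t)) has_field_derivative
      integral (cbox (0::real) 1) (\<lambda>t. pd2 f (circlepath z r t, w) * ?K t)) (at w within B)"
  proof (rule leibniz_rule_field_derivative[OF _ _ _ zw(3) B(2)])
    fix w t assume "w \<in> B" "t \<in> cbox (0::real) 1"
    show "((\<lambda>w. f (circlepath z r t, w) * ?K t) has_field_derivative
        pd2 f (circlepath z r t, w) * ?K t) (at w within B)"
      using holomorphic_derivI[OF s(3)[OF sph[of t]] B(1) \<open>w \<in> B\<close>]
      by (intro DERIV_cmult_right) (simp add: pd2_def DERIV_subset)
  next
    fix w assume "w \<in> B"
    show "(\<lambda>t. f (circlepath z r t, w) * ?K t) integrable_on cbox (0::real) 1"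
      by (rule integrable_continuous, intro continuous_on_mult K continuous_on_compose2[OF s(1)]
            continuous_on_Pair continuous_circlepath continuous_on_const) (use sph \<open>w \<in> B\<close> in auto)
  next
    show "continuous_on (B \<times> cbox (0::real) 1) (\<lambda>(w, t). pd2 f (circlepath z r t, w) * ?K t)"
      unfolding split_beta
      by (intro continuous_on_mult continuous_on_compose2[OF K[of UNIV]] continuous_on_compose2[OF s2(1)]
            continuous_on_Pair continuous_on_compose2[OF continuous_circlepath[of UNIV]]
            continuous_on_fst continuous_on_snd continuous_on_id) (use sph in auto)
  qed
  from DERIV_cdivide[OF this, of "2 * of_real pi * \<i>"]
  have "((\<lambda>w. integral (cbox (0::real) 1) (\<lambda>t. f (circlepath z r t, w) * ?K t) / (2 * of_real pi * \<i>))
      has_field_derivative pd1 (pd2 f) (z, w)) (at w)"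
    using cauchy[OF s2 zw(3)] at_within_open[OF zw(3) B(1)] by simp
  then have "((\<lambda>w. pd1 f (z, w)) has_field_derivative pd1 (pd2 f) (z, w)) (at w)"
    by (rule has_field_derivative_transform_within_open[OF _ B(1) zw(3)])
      (use cauchy[OF s(1,2)] in simp)
  then show ?thesis
    by (simp add: zw(1) pd2_def DERIV_imp_deriv)
qed

lemma pd1_funpow: "(pd1 ^^ n) f (x, y) = (deriv ^^ n) (\<lambda>x. f (x, y)) x"
proof (induction n arbitrary: x)
  case (Suc n)
  then show ?case by (simp add: pd1_def)
qed simp

lemma pd2_funpow: "(pd2 ^^ n) f (x, y) = (deriv ^^ n) (\<lambda>y. f (x, y)) y"
proof (induction n arbitrary: y)
  case (Suc n)
  then show ?case by (simp add: pd2_def)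
qed simp

text \<open>
  The one-variable identity theorem is used twice: in x on the axis y = 0 for all iterated
  y-derivatives, and then in y on each vertical disc.
\<close>

lemma holomorphic_eq_0_on_polydisc:
  assumes r: "r > 0" and f: "\<And>p. p \<in> ball 0 r \<times> ball 0 r \<Longrightarrow> complex_diff_at f p"
    and zero: "\<And>m n. (pd1 ^^ m) ((pd2 ^^ n) f) 0 = 0"
    and p: "p \<in> ball 0 r \<times> ball 0 r"
  shows "f p = 0"
proof -
  let ?D = "ball (0::complex) r"
  have d: "\<And>p. p \<in> ?D \<times> ?D \<Longrightarrow> complex_diff_at ((pd2 ^^ n) f) p" for n
  proof (induction n)
    case (Suc n)
    then show ?case
      using pd2_complex_diff_on[of ?D ?D "(pd2 ^^ n) f"] by simp
  qed (use f in simp)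
  have axis: "(pd2 ^^ n) f (x, 0) = 0" if "x \<in> ?D" for x n
  proof (rule holomorphic_fun_eq_0_on_connected[where z = 0 and S = ?D and f = "\<lambda>x. (pd2 ^^ n) f (x, 0)"])
    show "(\<lambda>x. (pd2 ^^ n) f (x, 0)) holomorphic_on ?D"
      by (rule complex_diff_at_imp_separately(2)[OF d]) (use r in auto)
    show "(deriv ^^ m) (\<lambda>x. (pd2 ^^ n) f (x, 0)) 0 = 0" for m
      using zero[of m n] by (simp add: zero_prod_def pd1_funpow)
  qed (use r that in auto)
  obtain x y where xy: "p = (x, y)" "x \<in> ?D" "y \<in> ?D" using p by auto
  have "f (x, y) = 0"
  proof (rule holomorphic_fun_eq_0_on_connected[where z = 0 and S = ?D and f = "\<lambda>y. f (x, y)"])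
    show "(\<lambda>y. f (x, y)) holomorphic_on ?D"
      by (rule complex_diff_at_imp_separately(3)[OF f]) (use xy in auto)
    show "(deriv ^^ n) (\<lambda>y. f (x, y)) 0 = 0" for n
      using axis[OF xy(2), of n] by (simp add: pd2_funpow)
  qed (use r xy in auto)
  then show ?thesis by (simp add: xy)
qed

lemma has_integral_along_ray:
  fixes g g' :: "complex \<Rightarrow> complex"
  assumes g: "\<And>z. z \<in> ball 0 r \<Longrightarrow> (g has_field_derivative g' z) (at z)" and x: "x \<in> ball 0 r"
  shows "((\<lambda>t::real. x * g' (t * x)) has_integral g x - g 0) (cbox 0 1)"
proof -
  have "((\<lambda>t. x * g' (of_real t * x)) has_integral g (of_real 1 * x) - g (of_real 0 * x)) {0..1}"
  proof (rule fundamental_theorem_of_calculus)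
    fix t :: real assume t: "t \<in> {0..1}"
    have "norm (of_real t * x) \<le> norm x"
      using t by (simp add: norm_mult mult_left_le_one_le)
    then have "of_real t * x \<in> ball 0 r" using x by simp
    from g[OF this]
    have "(g has_field_derivative g' (of_real t * x)) (at (of_real t * x))" .
    moreover have "((\<lambda>t. of_real t * x) has_vector_derivative x) (at t within {0..1})"
      by (auto intro!: derivative_eq_intros simp: has_vector_derivative_def scaleR_conv_of_real)
    ultimately have "((g \<circ> (\<lambda>t. of_real t * x)) has_vector_derivative x * g' (of_real t * x)) (at t within {0..1})"
      by (intro field_vector_diff_chain_within) (auto intro: has_field_derivative_at_within)
    then show "((\<lambda>t. g (of_real t * x)) has_vector_derivative x * g' (of_real t * x)) (at t within {0..1})"
      by (simp add: o_def)
  qed simp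
  then show ?thesis by simp
qed

text \<open>
  The primitive is obtained by integrating from the origin along the y-axis and then horizontally.
  It restricts to holomorphic functions on all slices, so continuity is enough for joint
  differentiability.
\<close>

lemma closed_imp_exact_on_polydisc:
  assumes r: "r > 0"
    and a: "\<And>p. p \<in> ball 0 r \<times> ball 0 r \<Longrightarrow> complex_diff_at a p"
    and b: "\<And>p. p \<in> ball 0 r \<times> ball 0 r \<Longrightarrow> complex_diff_at b p"
    and closed: "\<And>p. p \<in> ball 0 r \<times> ball 0 r \<Longrightarrow> pd1 b p = pd2 a p"
  obtains g where "\<And>p. p \<in> ball 0 r \<times> ball 0 r \<Longrightarrow>
    complex_diff_at g p \<and> pd1 g p = a p \<and> pd2 g p = b p"
proof -
  let ?D = "ball (0::complex) r"
  have D: "open ?D" "convex ?D" "0 \<in> ?D" using r by auto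
  have sa: "continuous_on (?D \<times> ?D) a" "\<And>w. w \<in> ?D \<Longrightarrow> (\<lambda>z. a (z, w)) holomorphic_on ?D"
    "\<And>z. z \<in> ?D \<Longrightarrow> (\<lambda>w. a (z, w)) holomorphic_on ?D"
    using complex_diff_at_imp_separately[of ?D ?D a] a by blast+
  have sb: "\<And>w. w \<in> ?D \<Longrightarrow> (\<lambda>z. b (z, w)) holomorphic_on ?D"
    "\<And>z. z \<in> ?D \<Longrightarrow> (\<lambda>w. b (z, w)) holomorphic_on ?D"
    using complex_diff_at_imp_separately[of ?D ?D b] b by blast+
  have ca2: "continuous_on (?D \<times> ?D) (pd2 a)"
    by (rule pd2_continuous_on[OF D(1) D(1) sa(1,3)])
  have ray: "of_real t * x \<in> ?D" if "x \<in> ?D" "t \<in> cbox (0::real) 1" for x t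
  proof -
    have "norm (of_real t * x) \<le> norm x"
      using that(2) by (simp add: norm_mult mult_left_le_one_le)
    then show ?thesis using that(1) by simp
  qed
  \<comment> \<open>the horizontal part, i.e. the integral of a(z, y) dz from z = 0 to z = x\<close>
  define F where "F = (\<lambda>p. integral (cbox 0 1) (\<lambda>t::real. fst p * a (of_real t * fst p, snd p)))"
  have F1: "((\<lambda>x. F (x, y)) has_field_derivative a (x, y)) (at x)" if "x \<in> ?D" "y \<in> ?D" for x y
  proof -
    obtain h where "\<And>z. z \<in> ?D \<Longrightarrow> (h has_field_derivative a (z, y)) (at z within ?D)"
      using holomorphic_convex_primitive'[OF D(2,1) sa(2)[OF \<open>y \<in> ?D\<close>]] by blast
    then have h: "\<And>z. z \<in> ?D \<Longrightarrow> (h has_field_derivative a (z, y)) (at z)"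
      using at_within_open[OF _ D(1)] by metis
    have Fh: "F (z, y) = h z - h 0" if "z \<in> ?D" for z
      using integral_unique[OF has_integral_along_ray[OF h that]] that by (simp add: F_def)
    have "((\<lambda>x. h x - h 0) has_field_derivative a (x, y)) (at x)"
      using h[OF that(1)] by (auto intro!: derivative_eq_intros)
    then show ?thesis
      by (rule has_field_derivative_transform_within_open[OF _ D(1) that(1)]) (simp add: Fh)
  qed
  have F2: "((\<lambda>y. F (x, y)) has_field_derivative b (x, y) - b (0, y)) (at y)"
    if "x \<in> ?D" "y \<in> ?D" for x y
  proof -
    have "((\<lambda>y. integral (cbox (0::real) 1) (\<lambda>t. x * a (of_real t * x, y))) has_field_derivative
        integral (cbox (0::real) 1) (\<lambda>t. x * pd2 a (of_real t * x, y))) (at y within ?D)"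
    proof (rule leibniz_rule_field_derivative[OF _ _ _ that(2) D(2)])
      fix y t assume "y \<in> ?D" "t \<in> cbox (0::real) 1"
      show "((\<lambda>y. x * a (of_real t * x, y)) has_field_derivative
          x * pd2 a (of_real t * x, y)) (at y within ?D)"
        using holomorphic_derivI[OF sa(3)[OF ray[OF that(1) \<open>t \<in> _\<close>]] D(1) \<open>y \<in> ?D\<close>]
        by (intro DERIV_cmult) (simp add: pd2_def DERIV_subset)
    next
      fix y assume "y \<in> ?D"
      show "(\<lambda>t. x * a (of_real t * x, y)) integrable_on cbox (0::real) 1"
        by (rule integrable_continuous)
          (use ray[OF that(1)] \<open>y \<in> ?D\<close> in \<open>auto intro!: continuous_intros continuous_on_compose2[OF sa(1)]\<close>)
    next
      show "continuous_on (?D \<times> cbox (0::real) 1) (\<lambda>(y, t). x * pd2 a (of_real t * x, y))"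
        unfolding split_beta
        by (use ray[OF that(1)] in \<open>auto intro!: continuous_intros continuous_on_compose2[OF ca2]\<close>)
    qed
    \<comment> \<open>by closedness the integrand is the derivative of b along a horizontal ray\<close>
    moreover have "integral (cbox (0::real) 1) (\<lambda>t. x * pd2 a (of_real t * x, y)) = b (x, y) - b (0, y)"
    proof -
      have "((\<lambda>z. b (z, y)) has_field_derivative pd2 a (z, y)) (at z)" if "z \<in> ?D" for z
        using holomorphic_derivI[OF sb(1)[OF \<open>y \<in> ?D\<close>] D(1) that] closed[of "(z, y)"] that \<open>y \<in> ?D\<close>
        by (simp add: pd1_def)
      from integral_unique[OF has_integral_along_ray[OF this \<open>x \<in> ?D\<close>]]
      show ?thesis by simp
    qed
    ultimately show ?thesis
      using at_within_open[OF that(2) D(1)] by (simp add: F_def)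
  qed
  \<comment> \<open>the vertical part, a primitive of b on the y-axis\<close>
  obtain B where "\<And>y. y \<in> ?D \<Longrightarrow> (B has_field_derivative b (0, y)) (at y within ?D)"
    using holomorphic_convex_primitive'[OF D(2,1) sb(2)[OF D(3)]] by blast
  then have B: "\<And>y. y \<in> ?D \<Longrightarrow> (B has_field_derivative b (0, y)) (at y)"
    using at_within_open[OF _ D(1)] by metis
  define g where "g = (\<lambda>p. F p + B (snd p))"
  have g1: "((\<lambda>x. g (x, y)) has_field_derivative a (x, y)) (at x)" if "x \<in> ?D" "y \<in> ?D" for x y
    unfolding g_def using F1[OF that] by (auto intro!: derivative_eq_intros)
  have g2: "((\<lambda>y. g (x, y)) has_field_derivative b (x, y)) (at y)" if "x \<in> ?D" "y \<in> ?D" for x y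
    using DERIV_add[OF F2[OF that] B[OF that(2)]] by (simp add: g_def)
  have hol: "\<And>w. w \<in> ?D \<Longrightarrow> (\<lambda>z. g (z, w)) holomorphic_on ?D"
    "\<And>z. z \<in> ?D \<Longrightarrow> (\<lambda>w. g (z, w)) holomorphic_on ?D"
    using g1 g2 unfolding holomorphic_on_open[OF D(1)] by blast+
  have "continuous_on (?D \<times> ?D) F"
  proof -
    have "continuous_on ((?D \<times> ?D) \<times> cbox (0::real) 1)
        (\<lambda>(p, t). fst p * a (of_real t * fst p, snd p))"
      unfolding split_beta
      by (use ray in \<open>auto intro!: continuous_intros continuous_on_compose2[OF sa(1)]\<close>)
    from integral_continuous_on_param[OF this] show ?thesis by (simp add: F_def)
  qed
  moreover have "continuous_on (?D \<times> ?D) (\<lambda>p. B (snd p))"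
  proof -
    have "continuous_on ?D B"
      using B by (meson DERIV_isCont continuous_at_imp_continuous_on)
    then show ?thesis
      by (rule continuous_on_compose2) (auto intro!: continuous_intros)
  qed
  ultimately have cont: "continuous_on (?D \<times> ?D) g"
    unfolding g_def by (rule continuous_on_add)
  have "complex_diff_at g p \<and> pd1 g p = a p \<and> pd2 g p = b p" if p: "p \<in> ?D \<times> ?D" for p
    using separately_holomorphic_imp_complex_diff[OF D(1) D(1,2) cont hol p]
      g1[of "fst p" "snd p"] g2[of "fst p" "snd p"] p
    by (auto simp: pd1_def pd2_def DERIV_imp_deriv mem_Times_iff)
  then show thesis by (rule that)
qed

lemma complex_diff_at_inverse:
  assumes "complex_diff_at f p" "f p \<noteq> 0"
  shows "complex_diff_at (\<lambda>q. inverse (f q)) p"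
proof -
  obtain a b where f: "(f has_derivative (\<lambda>v. a * fst v + b * snd v)) (at p)"
    using assms(1) unfolding complex_diff_at_def by blast
  let ?i = "inverse (f p)"
  have "((\<lambda>q. inverse (f q)) has_derivative
      (\<lambda>v. (- (?i * a * ?i)) * fst v + (- (?i * b * ?i)) * snd v)) (at p)"
    using Deriv.has_derivative_inverse[OF assms(2) f] by (simp add: algebra_simps)
  then show ?thesis unfolding complex_diff_at_def by blast
qed

section \<open>The local differential ring of germs\<close>

lemma eventually_polydiscI:
  assumes "r > 0" "\<And>p. p \<in> ball 0 r \<times> ball 0 r \<Longrightarrow> P p"
  shows "\<forall>\<^sub>F p in nhds (0::C2). P p"
  unfolding eventually_nhds
  by (rule exI[of _ "ball 0 r \<times> ball 0 r"]) (use assms in \<open>auto intro: open_Times simp: zero_prod_def\<close>)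

lemma eventually_polydiscE:
  assumes "\<forall>\<^sub>F p in nhds (0::C2). P p"
  obtains r where "r > 0" "\<And>p. p \<in> ball 0 r \<times> ball 0 r \<Longrightarrow> P p"
proof -
  obtain S where S: "open S" "(0::C2) \<in> S" "\<And>p. p \<in> S \<Longrightarrow> P p"
    using assms unfolding eventually_nhds by blast
  then obtain A B where AB: "open A" "open B" "0 \<in> A \<times> B" "A \<times> B \<subseteq> S"
    using open_prod_elim by metis
  then have "0 \<in> A" "0 \<in> B" by (auto simp: zero_prod_def)
  obtain r1 where r1: "r1 > 0" "ball 0 r1 \<subseteq> A"
    using open_contains_ball[of A] \<open>0 \<in> A\<close> AB(1) by blast
  obtain r2 where r2: "r2 > 0" "ball 0 r2 \<subseteq> B"
    using open_contains_ball[of B] \<open>0 \<in> B\<close> AB(2) by blast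
  have "ball 0 (min r1 r2) \<times> ball 0 (min r1 r2) \<subseteq> S" "min r1 r2 > 0"
    using r1 r2 AB(4) by (auto intro!: subsetD[OF AB(4)])
  then show thesis using that S(3) by blast
qed

lemma germ_cases:
  obtains f where "holomorphic_near0 f" "a = abs_germ f"
  using Quotient_abs_rep[OF Quotient_germ, of a, symmetric] Quotient_rep_reflp[OF Quotient_germ, of a]
  by blast

lemma germ_unit_inverse:
  assumes "val0 u \<noteq> 0"
  obtains v where "u * v = 1"
proof -
  obtain f where f: "holomorphic_near0 f" "u = abs_germ f" by (rule germ_cases)
  have "complex_diff_at f 0"
    using f(1) by (simp add: holomorphic_near0_def eventually_nhds_x_imp_x)
  then have "isCont f 0"
    unfolding complex_diff_at_def by (auto dest: has_derivative_continuous)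
  then have "(f \<longlongrightarrow> f 0) (nhds 0)"
    by (simp add: isCont_def tendsto_at_iff_tendsto_nhds)
  moreover have "f 0 \<noteq> 0"
    using assms f by (simp add: val0.abs_eq)
  ultimately have ne: "\<forall>\<^sub>F p in nhds 0. f p \<noteq> 0"
    by (rule tendsto_imp_eventually_ne)
  have h: "holomorphic_near0 (\<lambda>q. inverse (f q))"
    using f(1) ne unfolding holomorphic_near0_def
    by eventually_elim (rule complex_diff_at_inverse)
  have "u * abs_germ (\<lambda>q. inverse (f q)) = abs_germ (\<lambda>p. f p * inverse (f p))"
    using f h by (simp add: times_germ.abs_eq)
  also have "\<dots> = abs_germ (\<lambda>_. 1)"
    by (rule Quotient_rel_abs[OF Quotient_germ])
      (use ne in \<open>auto simp: holomorphic_near0_const intro!: holomorphic_near0_mult f h elim: eventually_mono\<close>)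
  finally show thesis using that by (simp add: one_germ_def)
qed

lemma val0_prod: "val0 (\<Prod>i\<in>A. a i) = (\<Prod>i\<in>A. val0 (a i))"
  by (induction A rule: infinite_finite_induct) auto

lemma germ_module: "module ((*) :: germ \<Rightarrow> germ \<Rightarrow> germ)"
  by standard (simp_all add: algebra_simps)

lemma D_germ_const [simp]: "D1 (germ_const c) = 0" "D2 (germ_const c) = 0"
proof -
  have "pd1 (\<lambda>_. c) = (\<lambda>_. 0)" "pd2 (\<lambda>_. c) = (\<lambda>_. 0)"
    by (simp_all add: fun_eq_iff pd1_def pd2_def)
  then show "D1 (germ_const c) = 0" "D2 (germ_const c) = 0"
    by (simp_all add: germ_const_def zero_germ_def D1.abs_eq D2.abs_eq holomorphic_near0_const)
qed

lemma D_zero_one [simp]: "D1 0 = 0" "D2 0 = 0" "D1 1 = 0" "D2 1 = 0"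
  using D_germ_const[of 0] D_germ_const[of 1] by simp_all

lemma D_uminus [simp]: "D1 (- a) = - D1 a" "D2 (- a) = - D2 a"
proof -
  have "D1 a + D1 (- a) = 0" "D2 a + D2 (- a) = 0"
    using D_add[of a "- a"] by simp_all
  then show "D1 (- a) = - D1 a" "D2 (- a) = - D2 a"
    using minus_unique by metis+
qed

lemma D_diff: "D1 (a - b) = D1 a - D1 b" "D2 (a - b) = D2 a - D2 b"
  using D_add[of a "- b"] by (simp_all only: D_uminus diff_conv_add_uminus)

lemma D_commute: "D2 (D1 a) = D1 (D2 a)"
proof -
  obtain f where f: "holomorphic_near0 f" "a = abs_germ f" by (rule germ_cases)
  obtain r where r: "r > 0" "\<And>p. p \<in> ball 0 r \<times> ball 0 r \<Longrightarrow> complex_diff_at f p"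
    using holomorphic_near0_polydisc[OF f(1)] by blast
  have "\<forall>\<^sub>F p in nhds 0. pd2 (pd1 f) p = pd1 (pd2 f) p"
    by (rule eventually_polydiscI[OF r(1)])
      (rule pd_commute_on[OF open_ball convex_ball open_ball convex_ball r(2)])
  then have "abs_germ (pd2 (pd1 f)) = abs_germ (pd1 (pd2 f))"
    by (intro Quotient_rel_abs[OF Quotient_germ]) (auto intro!: holomorphic_near0_pd1 holomorphic_near0_pd2 f)
  then show ?thesis
    using f by (simp add: D1.abs_eq D2.abs_eq holomorphic_near0_pd1 holomorphic_near0_pd2)
qed

text \<open>
  The identity theorem in differential-algebraic form: all Taylor coefficients of an element of
  such a set are values at 0 of elements of the set.
\<close>

lemma D_closed_vanishing_imp_zero:
  assumes D: "\<And>a. a \<in> I \<Longrightarrow> D1 a \<in> I" "\<And>a. a \<in> I \<Longrightarrow> D2 a \<in> I"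
    and val0: "\<And>a. a \<in> I \<Longrightarrow> val0 a = 0" and g: "g \<in> I"
  shows "g = 0"
proof -
  obtain f where f: "holomorphic_near0 f" "g = abs_germ f" by (rule germ_cases)
  obtain r where r: "r > 0" "\<And>p. p \<in> ball 0 r \<times> ball 0 r \<Longrightarrow> complex_diff_at f p"
    using holomorphic_near0_polydisc[OF f(1)] by blast
  have 2: "holomorphic_near0 ((pd2 ^^ n) f) \<and> abs_germ ((pd2 ^^ n) f) \<in> I" for n
  proof (induction n)
    case (Suc n)
    then show ?case
      using D(2)[of "abs_germ ((pd2 ^^ n) f)"] by (simp add: D2.abs_eq holomorphic_near0_pd2)
  qed (use f g in simp)
  have 1: "holomorphic_near0 ((pd1 ^^ m) ((pd2 ^^ n) f)) \<and> abs_germ ((pd1 ^^ m) ((pd2 ^^ n) f)) \<in> I" for m n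
  proof (induction m)
    case (Suc m)
    then show ?case
      using D(1)[of "abs_germ ((pd1 ^^ m) ((pd2 ^^ n) f))"] by (simp add: D1.abs_eq holomorphic_near0_pd1)
  qed (use 2 in simp)
  have "(pd1 ^^ m) ((pd2 ^^ n) f) 0 = 0" for m n
    using val0[of "abs_germ ((pd1 ^^ m) ((pd2 ^^ n) f))"] 1[of m n] by (simp add: val0.abs_eq)
  then have "\<forall>\<^sub>F p in nhds 0. f p = 0"
    by (intro eventually_polydiscI[OF r(1)] holomorphic_eq_0_on_polydisc[OF r])
  then have "abs_germ f = abs_germ (\<lambda>_. 0)"
    by (intro Quotient_rel_abs[OF Quotient_germ]) (auto intro: f holomorphic_near0_const)
  then show ?thesis using f by (simp add: zero_germ_def)
qed

lemma D_zero_imp_const: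
  assumes "D1 g = 0" "D2 g = 0"
  shows "g = germ_const (val0 g)"
proof -
  have "g - germ_const (val0 g) = 0"
    by (rule D_closed_vanishing_imp_zero[of "{g - germ_const (val0 g), 0}"])
      (use assms in \<open>auto simp: D_diff\<close>)
  then show ?thesis by simp
qed

lemma poincare:
  assumes "ext_d1 \<eta> = 0"
  obtains g where "ext_d0 g = \<eta>"
proof -
  obtain a where a: "holomorphic_near0 a" "fst \<eta> = abs_germ a" by (rule germ_cases)
  obtain b where b: "holomorphic_near0 b" "snd \<eta> = abs_germ b" by (rule germ_cases)
  have "abs_germ (pd1 b) = abs_germ (pd2 a)"
    using assms a b by (simp add: ext_d1_def D1.abs_eq D2.abs_eq)
  then have "\<forall>\<^sub>F p in nhds 0. pd1 b p = pd2 a p"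
    using Quotient_rel[OF Quotient_germ, of "pd1 b" "pd2 a"] a b
    by (auto simp: holomorphic_near0_pd1 holomorphic_near0_pd2)
  moreover have "\<forall>\<^sub>F p in nhds 0. complex_diff_at a p" "\<forall>\<^sub>F p in nhds 0. complex_diff_at b p"
    using a b by (simp_all add: holomorphic_near0_def)
  ultimately have "\<forall>\<^sub>F p in nhds (0::C2). pd1 b p = pd2 a p \<and> complex_diff_at a p \<and> complex_diff_at b p"
    by eventually_elim auto
  then obtain r where r: "r > 0" "\<And>p. p \<in> ball 0 r \<times> ball 0 r \<Longrightarrow>
      pd1 b p = pd2 a p \<and> complex_diff_at a p \<and> complex_diff_at b p"
    by (rule eventually_polydiscE) blast
  obtain g where g: "\<And>p. p \<in> ball 0 r \<times> ball 0 r \<Longrightarrow>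
      complex_diff_at g p \<and> pd1 g p = a p \<and> pd2 g p = b p"
    using closed_imp_exact_on_polydisc[of r a b] r by blast
  have hg: "holomorphic_near0 g"
    by (rule holomorphic_near0I[OF r(1)]) (use g in blast)
  have "\<forall>\<^sub>F p in nhds 0. pd1 g p = a p" "\<forall>\<^sub>F p in nhds 0. pd2 g p = b p"
    by (rule eventually_polydiscI[OF r(1)]; use g in blast)+
  then have "abs_germ (pd1 g) = abs_germ a" "abs_germ (pd2 g) = abs_germ b"
    by (auto intro!: Quotient_rel_abs[OF Quotient_germ] intro: holomorphic_near0_pd1 holomorphic_near0_pd2 a b hg)
  then have "ext_d0 (abs_germ g) = \<eta>"
    using a b hg by (simp add: ext_d0_def D1.abs_eq D2.abs_eq prod_eq_iff)
  then show thesis by (rule that)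
qed

section \<open>Finite-dimensional linear algebra\<close>

text \<open>
  Each functional cuts the subspace down by at most one dimension, and the common kernel is zero.
\<close>

lemma (in vector_space) finite_spanning_set_of_separating_functionals:
  assumes "finite N" "subspace V"
    and add: "\<And>n x y. n \<in> N \<Longrightarrow> \<phi> n (x + y) = \<phi> n x + \<phi> n y"
    and scale: "\<And>n c x. n \<in> N \<Longrightarrow> \<phi> n (scale c x) = c * \<phi> n x"
    and sep: "\<And>v. v \<in> V \<Longrightarrow> \<forall>n\<in>N. \<phi> n v = 0 \<Longrightarrow> v = 0"
  obtains B where "finite B" "V \<subseteq> span B"
proof -
  have "\<exists>B. finite B \<and> V \<subseteq> span B"
    using assms
  proof (induction N arbitrary: V rule: finite_induct)
    case empty
    then have "V \<subseteq> span {}" by auto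
    then show ?case by blast
  next
    case (insert n N)
    let ?K = "{v \<in> V. \<phi> n v = 0}"
    have z: "\<phi> n 0 = 0"
      using insert.prems(3)[of n 0 0] by simp
    have "subspace ?K"
      using insert.prems z unfolding subspace_def by auto
    then obtain B where B: "finite B" "?K \<subseteq> span B"
      using insert.IH[of ?K] insert.prems by auto
    show ?case
    proof (cases "\<exists>w\<in>V. \<phi> n w \<noteq> 0")
      case True
      then obtain w where w: "w \<in> V" "\<phi> n w \<noteq> 0" by blast
      have "v \<in> span (insert w B)" if "v \<in> V" for v
      proof -
        let ?c = "\<phi> n v / \<phi> n w"
        let ?u = "v - scale ?c w"
        have "?u \<in> V"
          using insert.prems(1) that w(1) by (intro subspace_diff subspace_scale)
        moreover have "\<phi> n ?u = 0"
        proof -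
          have "\<phi> n (?u + scale ?c w) = \<phi> n ?u + \<phi> n (scale ?c w)"
            by (rule insert.prems(2)) simp
          then show ?thesis using w(2) insert.prems(3)[of n ?c w] by simp
        qed
        ultimately have "?u \<in> span B" using B by blast
        then show ?thesis unfolding span_insert by blast
      qed
      then show ?thesis using B(1) by (intro exI[of _ "insert w B"]) auto
    next
      case False
      then show ?thesis using B by (intro exI[of _ B]) auto
    qed
  qed
  then show thesis using that by blast
qed

text \<open>
  The ambient space of tuples of forms is infinite-dimensional and dimension is 0 on subspaces
  without a finite basis, so finite spanning sets of kernel and image are hypotheses.
\<close>

lemma (in vector_space) rank_nullity:
  assumes V: "subspace V"
    and add: "\<And>x y. f (x + y) = f x + f y" and scale: "\<And>c x. f (scale c x) = scale c (f x)"
    and K: "finite C" "{v \<in> V. f v = 0} \<subseteq> span C"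
    and I: "finite D" "f ` V \<subseteq> span D"
  shows "dim V = dim {v \<in> V. f v = 0} + dim (f ` V)"
proof -
  let ?K = "{v \<in> V. f v = 0}"
  obtain B0 where B0: "B0 \<subseteq> ?K" "independent B0" "?K \<subseteq> span B0" "card B0 = dim ?K"
    by (rule basis_exists)
  obtain B1 where B1: "B1 \<subseteq> f ` V" "independent B1" "f ` V \<subseteq> span B1" "card B1 = dim (f ` V)"
    by (rule basis_exists)
  have fin: "finite B0" "finite B1"
    using independent_span_bound[OF K(1) B0(2)] independent_span_bound[OF I(1) B1(2)] B0 B1 K I
    by blast+
  have f0: "f 0 = 0" using add[of 0 0] by simp
  have fsum: "f (\<Sum>x\<in>S. scale (u x) (h x)) = (\<Sum>x\<in>S. scale (u x) (f (h x)))" for S u and h :: "'b \<Rightarrow> 'b"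
    by (induction S rule: infinite_finite_induct) (auto simp: f0 add scale)
  obtain g where g: "\<And>b. b \<in> B1 \<Longrightarrow> g b \<in> V \<and> f (g b) = b"
    using B1(1) by (metis (no_types, lifting) image_iff subset_iff)
  have inj: "inj_on g B1" by (metis g inj_onI)
  have fB0: "f b = 0" if "b \<in> B0" for b using B0(1) that by blast
  have disj: "B0 \<inter> g ` B1 = {}"
    using fB0 g B1(2) dependent_zero by fastforce
  have "independent (B0 \<union> g ` B1)"
  proof (rule independent_if_scalars_zero)
    fix u x assume s: "(\<Sum>x\<in>B0 \<union> g ` B1. scale (u x) x) = 0" and x: "x \<in> B0 \<union> g ` B1"
    have s': "(\<Sum>x\<in>B0. scale (u x) x) + (\<Sum>b\<in>B1. scale (u (g b)) (g b)) = 0"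
      using s fin disj by (simp add: sum.union_disjoint sum.reindex[OF inj])
    have "f (\<Sum>x\<in>B0. scale (u x) x) = 0"
      using fsum[of u "\<lambda>x. x" B0] by (simp add: fB0)
    moreover have "f (\<Sum>b\<in>B1. scale (u (g b)) (g b)) = (\<Sum>b\<in>B1. scale (u (g b)) b)"
      using fsum[of "u \<circ> g" g B1] by (simp add: g)
    ultimately have "(\<Sum>b\<in>B1. scale (u (g b)) b) = 0"
      using arg_cong[OF s', of f] by (simp add: add f0)
    then have u1: "u (g b) = 0" if "b \<in> B1" for b
      using independentD[OF B1(2) fin(2) subset_refl, of "\<lambda>b. u (g b)"] that by blast
    then have "(\<Sum>x\<in>B0. scale (u x) x) = 0" using s' by simp
    then have "u b = 0" if "b \<in> B0" for b
      using independentD[OF B0(2) fin(1) subset_refl] that by blast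
    then show "u x = 0" using x u1 by blast
  qed (use fin in simp)
  moreover have "V \<subseteq> span (B0 \<union> g ` B1)"
  proof
    fix v assume v: "v \<in> V"
    then have "f v \<in> range (\<lambda>u. \<Sum>b\<in>B1. scale (u b) b)"
      using B1(3) span_finite[OF fin(2)] by blast
    then obtain u where u: "f v = (\<Sum>b\<in>B1. scale (u b) b)" by blast
    let ?w = "\<Sum>b\<in>B1. scale (u b) (g b)"
    have "?w \<in> V"
      using g by (intro subspace_sum[OF V] subspace_scale[OF V]) auto
    moreover have "f ?w = f v"
      using fsum[of u g B1] by (simp add: g u)
    moreover have "f (v - ?w + ?w) = f (v - ?w) + f ?w" by (rule add)
    ultimately have "v - ?w \<in> ?K"
      using v V by (simp add: subspace_diff)
    then have "v - ?w \<in> span (B0 \<union> g ` B1)"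
      using B0(3) span_mono[of B0 "B0 \<union> g ` B1"] by blast
    moreover have "?w \<in> span (B0 \<union> g ` B1)"
      by (intro span_sum span_scale span_base) auto
    ultimately have "v - ?w + ?w \<in> span (B0 \<union> g ` B1)" by (rule span_add)
    then show "v \<in> span (B0 \<union> g ` B1)" by simp
  qed
  moreover have "B0 \<union> g ` B1 \<subseteq> V" using B0(1) g by auto
  ultimately have "dim V = card (B0 \<union> g ` B1)"
    using basis_card_eq_dim by metis
  also have "\<dots> = card B0 + card B1"
    using fin disj inj by (simp add: card_Un_disjoint card_image)
  finally show ?thesis using B0(4) B1(4) by simp
qed

section \<open>Forms with normalised contraction\<close>

definition gmult :: "germ \<Rightarrow> one_form \<Rightarrow> one_form" (infixr "\<cdot>" 75) where
  "h \<cdot> \<theta> = (h * fst \<theta>, h * snd \<theta>)"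

definition along :: "vector_field \<Rightarrow> germ \<Rightarrow> germ" where
  "along X h = contract1 X (ext_d0 h)"

lemma contract1_simps [simp]:
  "contract1 X 0 = 0" "contract1 X (\<eta> + \<zeta>) = contract1 X \<eta> + contract1 X \<zeta>"
  "contract1 X (- \<eta>) = - contract1 X \<eta>" "contract1 X (\<eta> - \<zeta>) = contract1 X \<eta> - contract1 X \<zeta>"
  "contract1 X (h \<cdot> \<eta>) = h * contract1 X \<eta>"
  by (simp_all add: contract1_def gmult_def algebra_simps)

lemma contract1_sum: "contract1 X (\<Sum>i\<in>A. \<eta> i) = (\<Sum>i\<in>A. contract1 X (\<eta> i))"
  by (induction A rule: infinite_finite_induct) auto

lemma ext_d0_simps [simp]:
  "ext_d0 0 = 0" "ext_d0 1 = 0" "ext_d0 (germ_const c) = 0"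
  "ext_d0 (a + b) = ext_d0 a + ext_d0 b" "ext_d0 (- a) = - ext_d0 a" "ext_d0 (a - b) = ext_d0 a - ext_d0 b"
  by (simp_all add: ext_d0_def D_add D_diff zero_prod_def)

lemma ext_d0_sum: "ext_d0 (\<Sum>i\<in>A. h i) = (\<Sum>i\<in>A. ext_d0 (h i))"
  by (induction A rule: infinite_finite_induct) auto

lemma ext_d1_simps [simp]:
  "ext_d1 0 = 0" "ext_d1 (\<eta> + \<zeta>) = ext_d1 \<eta> + ext_d1 \<zeta>"
  "ext_d1 (- \<eta>) = - ext_d1 \<eta>" "ext_d1 (\<eta> - \<zeta>) = ext_d1 \<eta> - ext_d1 \<zeta>"
  by (simp_all add: ext_d1_def D_add D_diff)

lemma ext_d1_sum: "ext_d1 (\<Sum>i\<in>A. \<eta> i) = (\<Sum>i\<in>A. ext_d1 (\<eta> i))"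
  by (induction A rule: infinite_finite_induct) auto

lemma ext_d1_gmult: "ext_d1 (h \<cdot> \<theta>) = wedge (ext_d0 h) \<theta> + h * ext_d1 \<theta>"
  by (simp add: ext_d1_def gmult_def wedge_def ext_d0_def D_mult algebra_simps)

lemma ext_d1_ext_d0 [simp]: "ext_d1 (ext_d0 h) = 0"
  by (simp add: ext_d1_def ext_d0_def D_commute)

lemma wedge_simps [simp]:
  "wedge 0 \<theta> = 0" "wedge (\<eta> + \<zeta>) \<theta> = wedge \<eta> \<theta> + wedge \<zeta> \<theta>"
  "wedge (- \<eta>) \<theta> = - wedge \<eta> \<theta>" "wedge (\<eta> - \<zeta>) \<theta> = wedge \<eta> \<theta> - wedge \<zeta> \<theta>"
  "wedge (h \<cdot> \<eta>) \<theta> = h * wedge \<eta> \<theta>" "wedge \<theta> \<theta> = 0"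
  by (simp_all add: wedge_def gmult_def algebra_simps)

lemma gmult_simps [simp]: "0 \<cdot> \<theta> = 0" "(a + b) \<cdot> \<theta> = a \<cdot> \<theta> + b \<cdot> \<theta>"
  "h \<cdot> (\<eta> + \<zeta>) = h \<cdot> \<eta> + h \<cdot> \<zeta>" "h \<cdot> (0::one_form) = 0" "(- a) \<cdot> \<theta> = - (a \<cdot> \<theta>)"
  "h \<cdot> (- \<eta>) = - (h \<cdot> \<eta>)" "h \<cdot> (\<eta> - \<zeta>) = h \<cdot> \<eta> - h \<cdot> \<zeta>"
  by (simp_all add: gmult_def zero_prod_def algebra_simps)

lemma gmult_sum_right: "h \<cdot> (\<Sum>i\<in>A. \<theta> i) = (\<Sum>i\<in>A. h \<cdot> \<theta> i)"
  by (induction A rule: infinite_finite_induct) auto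

lemma along_simps [simp]:
  "along X 0 = 0" "along X (a + b) = along X a + along X b"
  "along X (germ_const c * a) = germ_const c * along X a"
  by (simp_all add: along_def) (simp add: contract1_def ext_d0_def D_mult algebra_simps)

lemma along_funpow_linear:
  "(along X ^^ n) (a + b) = (along X ^^ n) a + (along X ^^ n) b"
  "(along X ^^ n) (germ_const c * a) = germ_const c * (along X ^^ n) a"
  by (induction n) auto

lemma along_mult: "along X (a * b) = along X a * b + a * along X b"
  by (simp add: along_def contract1_def ext_d0_def D_mult algebra_simps)

lemma along_sum: "along X (\<Sum>i\<in>A. h i) = (\<Sum>i\<in>A. along X (h i))"
  by (induction A rule: infinite_finite_induct) auto

lemma lie_deriv_closed: "ext_d1 \<eta> = 0 \<Longrightarrow> lie_deriv X \<eta> = ext_d0 (contract1 X \<eta>)"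
  by (simp add: lie_deriv_def contract2_def zero_prod_def[symmetric])

lemma lie_deriv_simps [simp]:
  "lie_deriv X 0 = 0" "lie_deriv X (\<eta> + \<zeta>) = lie_deriv X \<eta> + lie_deriv X \<zeta>"
  "lie_deriv X (germ_const c \<cdot> \<eta>) = germ_const c \<cdot> lie_deriv X \<eta>"
  by (simp_all add: lie_deriv_def contract2_def zero_prod_def[symmetric] algebra_simps)
    (simp add: ext_d1_def ext_d0_def contract1_def gmult_def D_mult D_add algebra_simps)

lemma lie_deriv_sum: "lie_deriv X (\<Sum>i\<in>A. \<eta> i) = (\<Sum>i\<in>A. lie_deriv X (\<eta> i))"
  by (induction A rule: infinite_finite_induct) auto

text \<open>
  Contracting \<open>\<eta> \<and> \<theta> = 0\<close> with X gives \<open>\<eta>(X) \<theta> - \<theta>(X) \<eta> = 0\<close>; the two components of this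
  identity are computed here.
\<close>

lemma wedge_zero_normalised:
  assumes "wedge \<eta> \<theta> = 0" "contract1 X \<theta> = 1"
  shows "\<eta> = contract1 X \<eta> \<cdot> \<theta>"
proof -
  have e: "fst \<eta> * snd \<theta> = snd \<eta> * fst \<theta>" using assms(1) by (simp add: wedge_def)
  have 1: "fst \<theta> * fst X + snd \<theta> * snd X = 1" using assms(2) by (simp add: contract1_def)
  have "fst \<eta> = (fst \<theta> * fst X + snd \<theta> * snd X) * fst \<eta>" by (simp add: 1)
  also have "\<dots> = fst \<theta> * fst X * fst \<eta> + (fst \<eta> * snd \<theta>) * snd X" by (simp add: algebra_simps)
  also have "\<dots> = contract1 X \<eta> * fst \<theta>" unfolding e by (simp add: contract1_def algebra_simps)
  finally have f: "fst \<eta> = contract1 X \<eta> * fst \<theta>" .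
  have "snd \<eta> = (fst \<theta> * fst X + snd \<theta> * snd X) * snd \<eta>" by (simp add: 1)
  also have "\<dots> = (snd \<eta> * fst \<theta>) * fst X + snd \<theta> * snd X * snd \<eta>" by (simp add: algebra_simps)
  also have "\<dots> = contract1 X \<eta> * snd \<theta>" unfolding e[symmetric] by (simp add: contract1_def algebra_simps)
  finally show ?thesis using f by (simp add: gmult_def prod_eq_iff)
qed

lemma tuple_scale_gmult: "tuple_scale c \<eta> i = germ_const c \<cdot> \<eta> i"
  by (simp add: tuple_scale_def gmult_def)

lemma tuple_sum_apply: "(\<Sum>x\<in>A. (f x :: nat \<Rightarrow> one_form)) i = (\<Sum>x\<in>A. f x i)"
  by (induction A rule: infinite_finite_induct) auto

text \<open>
  Dividing a defining form \<open>\<omega>\<close> by \<open>\<omega>(X)\<close> produces a form \<open>\<theta>\<close> with \<open>\<theta>(X) = 1\<close>. For such a form the Lie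
  derivative is \<open>i\<^sub>X d\<theta>\<close>, and its wedge product with \<open>\<theta>\<close> is \<open>- d\<theta>\<close>. So invariance of the foliation under X
  is the closedness of \<open>\<theta>\<close>, which is the differential of a first integral u with \<open>X u = 1\<close>.
\<close>

lemma preserved_foliation_normal_form:
  assumes "preserves X F" "at0 X \<notin> tangent_space0 F"
  obtains \<theta> where "ext_d1 \<theta> = 0" "contract1 X \<theta> = 1" "at0 \<theta> \<noteq> 0" "F = abs_foliation \<theta>"
proof -
  obtain \<omega> where \<omega>: "at0 \<omega> \<noteq> 0" "F = abs_foliation \<omega>"
    using Quotient_abs_rep[OF Quotient_foliation, of F, symmetric]
      Quotient_rep_reflp[OF Quotient_foliation, of F] by blast
  have refl: "at0 \<omega> \<noteq> 0 \<and> at0 \<omega> \<noteq> 0 \<and> wedge \<omega> \<omega> = 0" using \<omega> by simp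
  have "val0 (contract1 X \<omega>) \<noteq> 0"
    using assms(2) refl unfolding \<omega>(2)
    by (simp add: tangent_space0.abs_eq at0_def contract1_def)
  then obtain u where u: "contract1 X \<omega> * u = 1" by (rule germ_unit_inverse)
  let ?\<theta> = "u \<cdot> \<omega>"
  have n: "contract1 X ?\<theta> = 1" using u by (simp add: mult.commute)
  have nz: "at0 ?\<theta> \<noteq> 0"
  proof
    assume "at0 ?\<theta> = 0"
    then have "val0 (contract1 X ?\<theta>) = 0"
      by (auto simp: at0_def zero_prod_def contract1_def gmult_def)
    then show False unfolding n by simp
  qed
  have F: "F = abs_foliation ?\<theta>"
    unfolding \<omega>(2)
    by (rule Quotient_rel_abs[OF Quotient_foliation])
      (use \<omega> nz in \<open>simp add: wedge_commute_zero[of "u \<cdot> \<omega>" \<omega>]\<close>)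
  have "wedge (lie_deriv X ?\<theta>) ?\<theta> = 0"
    using assms(1) nz unfolding F by (simp add: preserves.abs_eq)
  moreover have "wedge (lie_deriv X ?\<theta>) ?\<theta> = - (ext_d1 ?\<theta> * contract1 X ?\<theta>)"
  proof -
    have "lie_deriv X ?\<theta> = contract2 X (ext_d1 ?\<theta>)"
      by (simp only: lie_deriv_def n ext_d0_simps add_0_right)
    then show ?thesis
      by (simp add: wedge_def contract2_def contract1_def algebra_simps)
  qed
  ultimately have "ext_d1 ?\<theta> = 0" by (simp only: n) simp
  then show thesis using that n nz F by blast
qed

lemma vanishes_on_leaves_abs_foliation:
  "at0 \<theta> \<noteq> 0 \<Longrightarrow> vanishes_on_leaves \<eta> (abs_foliation \<theta>) \<longleftrightarrow> wedge \<eta> \<theta> = 0"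
  by (simp add: vanishes_on_leaves.abs_eq)

lemma vanishes_on_leaves_foliation_of:
  assumes "at0 X \<noteq> 0"
  shows "vanishes_on_leaves \<eta> (foliation_of X) \<longleftrightarrow> contract1 X \<eta> = 0"
proof -
  have "at0 (contract2 X 1) \<noteq> 0"
    using assms by (auto simp: at0_def contract2_def zero_prod_def)
  then show ?thesis
    by (simp add: foliation_of_def vanishes_on_leaves_abs_foliation wedge_def contract2_def contract1_def algebra_simps)
qed

text \<open>
  Proportional covectors that agree on X(0) are equal.
\<close>

lemma distinct_tangents_imp_wedge_nonzero:
  assumes "contract1 X \<theta> = 1" "contract1 X \<zeta> = 1" "at0 \<theta> \<noteq> 0" "at0 \<zeta> \<noteq> 0"
    and "tangent_space0 (abs_foliation \<theta>) \<noteq> tangent_space0 (abs_foliation \<zeta>)"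
  shows "val0 (wedge \<theta> \<zeta>) \<noteq> 0"
proof
  assume "val0 (wedge \<theta> \<zeta>) = 0"
  then have e: "val0 (fst \<theta>) * val0 (snd \<zeta>) = val0 (snd \<theta>) * val0 (fst \<zeta>)"
    by (simp add: wedge_def)
  have n: "val0 (fst \<theta>) * val0 (fst X) + val0 (snd \<theta>) * val0 (snd X) = 1"
    "val0 (fst \<zeta>) * val0 (fst X) + val0 (snd \<zeta>) * val0 (snd X) = 1"
    using arg_cong[OF assms(1), of val0] arg_cong[OF assms(2), of val0] by (simp_all add: contract1_def)
  have "val0 (fst \<theta>) = val0 (fst \<zeta>)" "val0 (snd \<theta>) = val0 (snd \<zeta>)"
    using e n by algebra+
  then have "tangent_space0 (abs_foliation \<theta>) = tangent_space0 (abs_foliation \<zeta>)"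
    using assms(3,4) by (simp add: tangent_space0.abs_eq)
  then show False using assms(5) by blast
qed

section \<open>Finiteness of the rank\<close>

text \<open>
  The foliations enter only through their normalised closed forms; \<open>\<theta> i\<close> is the differential of a
  first integral \<open>u\<^sub>i\<close> with \<open>X u\<^sub>i = 1\<close>.
\<close>

locale symmetric_web =
  fixes W :: "foliation list" and X :: vector_field and \<theta> :: "nat \<Rightarrow> one_form"
  assumes X_nonzero: "at0 X \<noteq> 0"
    and closed: "i < length W \<Longrightarrow> ext_d1 (\<theta> i) = 0"
    and normalised: "i < length W \<Longrightarrow> contract1 X (\<theta> i) = 1"
    and vanishes_iff: "i < length W \<Longrightarrow> vanishes_on_leaves \<eta> (W ! i) \<longleftrightarrow> wedge \<eta> (\<theta> i) = 0"
    and wedge_nonzero: "i < length W \<Longrightarrow> j < length W \<Longrightarrow> i \<noteq> j \<Longrightarrow> val0 (wedge (\<theta> i) (\<theta> j)) \<noteq> 0"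
begin

text \<open>
  A closed form that vanishes on the leaves of the i-th foliation is \<open>h \<cdot> \<theta> i\<close> for such an h, and
  \<open>dh = (X h) \<theta> i\<close>. Thus h behaves like a function of the single variable u with \<open>du = \<theta> i\<close>,
  with X as the derivative.
\<close>

definition first_integral :: "nat \<Rightarrow> germ \<Rightarrow> bool" where
  "first_integral i h \<longleftrightarrow> wedge (ext_d0 h) (\<theta> i) = 0"

lemma first_integral_ext_d0:
  "i < length W \<Longrightarrow> first_integral i h \<Longrightarrow> ext_d0 h = along X h \<cdot> \<theta> i"
  unfolding first_integral_def along_def by (rule wedge_zero_normalised[OF _ normalised])

text \<open>
  Taking the exterior derivative of \<open>dh = (X h) \<theta> i\<close> gives \<open>d(X h) \<and> \<theta> i = 0\<close>.
\<close>

lemma first_integral_along: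
  assumes "i < length W" "first_integral i h"
  shows "first_integral i (along X h)"
proof -
  have "ext_d1 (ext_d0 h) = ext_d1 (along X h \<cdot> \<theta> i)"
    using first_integral_ext_d0[OF assms] by simp
  then show ?thesis
    using assms(1) by (simp only: ext_d1_ext_d0 ext_d1_gmult closed first_integral_def) simp
qed

lemma first_integral_along_funpow:
  "i < length W \<Longrightarrow> first_integral i h \<Longrightarrow> first_integral i ((along X ^^ n) h)"
  by (induction n) (auto intro: first_integral_along)

lemma along_first_integral:
  "i < length W \<Longrightarrow> first_integral i h \<Longrightarrow> along Z h = along X h * contract1 Z (\<theta> i)"
  using first_integral_ext_d0[of i h] by (simp add: along_def[of Z])

text \<open>
  Here \<open>h l\<close> is meant to be the coefficient at \<open>\<theta> l\<close> of an abelian relation. If it is written as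
  \<open>f\<^sub>l(u\<^sub>l)\<close> with \<open>du\<^sub>l = \<theta> l\<close>, then the generators of this ideal are the derivatives of \<open>f\<^sub>l\<close>
  at \<open>u\<^sub>l\<close>.
\<close>

definition jet_ideal :: "(nat \<Rightarrow> germ) \<Rightarrow> nat \<Rightarrow> germ set" where
  "jet_ideal h n = module.span (*) {(along X ^^ j) (h l) | j l. j < n \<and> l < length W}"

lemma jet_ideal_base: "j < n \<Longrightarrow> l < length W \<Longrightarrow> (along X ^^ j) (h l) \<in> jet_ideal h n"
  unfolding jet_ideal_def by (rule module.span_base[OF germ_module]) blast

lemma jet_ideal_scale: "a \<in> jet_ideal h n \<Longrightarrow> c * a \<in> jet_ideal h n"
  unfolding jet_ideal_def by (rule module.span_scale[OF germ_module])

lemma jet_ideal_add: "a \<in> jet_ideal h n \<Longrightarrow> b \<in> jet_ideal h n \<Longrightarrow> a + b \<in> jet_ideal h n"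
  unfolding jet_ideal_def by (rule module.span_add[OF germ_module])

lemma jet_ideal_sum: "(\<And>l. l \<in> A \<Longrightarrow> f l \<in> jet_ideal h n) \<Longrightarrow> sum f A \<in> jet_ideal h n"
  unfolding jet_ideal_def by (rule module.span_sum[OF germ_module])

text \<open>
  By \<open>along_first_integral\<close> every vector field Z differentiates a generator in the direction of X
  up to a factor.
\<close>

lemma jet_ideal_along:
  assumes h: "\<And>l. l < length W \<Longrightarrow> first_integral l (h l)" and a: "a \<in> jet_ideal h n"
  shows "along Z a \<in> jet_ideal h (Suc n)"
  using a unfolding jet_ideal_def[of h n]
proof (induction a rule: module.span_induct_alt[OF germ_module, consumes 1, case_names base step])
  case base
  then show ?case by (simp add: jet_ideal_def module.span_zero[OF germ_module])
next
  case (step c x y)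
  then obtain j l where jl: "x = (along X ^^ j) (h l)" "j < n" "l < length W" by auto
  have "along Z x = contract1 Z (\<theta> l) * (along X ^^ Suc j) (h l)"
    using along_first_integral[OF jl(3) first_integral_along_funpow[OF jl(3) h[OF jl(3)]], where Z = Z]
    unfolding jl(1) by (simp only: funpow.simps o_apply mult.commute)
  then have "along Z (c * x + y) = along Z c * (along X ^^ j) (h l)
      + (c * contract1 Z (\<theta> l)) * (along X ^^ Suc j) (h l) + along Z y"
    by (simp add: along_mult jl(1) algebra_simps)
  moreover have "(along X ^^ j) (h l) \<in> jet_ideal h (Suc n)" "(along X ^^ Suc j) (h l) \<in> jet_ideal h (Suc n)"
    using jl by (intro jet_ideal_base; simp)+
  ultimately show ?case
    using step.IH by (simp only: jet_ideal_add jet_ideal_scale)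
qed

text \<open>
  The relation \<open>\<Sum>l. h l = 0\<close> is differentiated successively along vector fields tangent to the
  foliations with index in T. The field tangent to the m-th foliation multiplies the top order term of index l
  by \<open>wedge (\<theta> l) (\<theta> m)\<close>, which is 0 for l = m; all other terms have lower order.
\<close>

lemma jet_ideal_elimination:
  assumes h: "\<And>l. l < length W \<Longrightarrow> first_integral l (h l)" and sum: "(\<Sum>l<length W. h l) = 0"
    and T: "finite T" "T \<subseteq> {..<length W}"
  shows "(\<Sum>l<length W. (\<Prod>m\<in>T. wedge (\<theta> l) (\<theta> m)) * (along X ^^ card T) (h l)) \<in> jet_ideal h (card T)"
  using T
proof (induction T rule: finite_induct)
  case empty
  then show ?case by (simp add: sum jet_ideal_def module.span_zero[OF germ_module])
next
  case (insert m T)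
  \<comment> \<open>Z spans the kernel of the m-th normalised form\<close>
  let ?n = "card T" and ?Z = "(snd (\<theta> m), - fst (\<theta> m))"
  let ?c = "\<lambda>l. \<Prod>m\<in>T. wedge (\<theta> l) (\<theta> m)"
  have Z: "contract1 ?Z (\<theta> l) = wedge (\<theta> l) (\<theta> m)" for l
    by (simp add: contract1_def wedge_def)
  have "along ?Z (\<Sum>l<length W. ?c l * (along X ^^ ?n) (h l)) \<in> jet_ideal h (Suc ?n)"
    by (rule jet_ideal_along[OF h insert.IH]) (use insert.prems in auto)
  also have "along ?Z (\<Sum>l<length W. ?c l * (along X ^^ ?n) (h l)) =
      (\<Sum>l<length W. along ?Z (?c l) * (along X ^^ ?n) (h l))
      + (\<Sum>l<length W. (wedge (\<theta> l) (\<theta> m) * ?c l) * (along X ^^ Suc ?n) (h l))"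
    unfolding along_sum sum.distrib[symmetric]
  proof (rule sum.cong[OF refl])
    fix l assume "l \<in> {..<length W}"
    then have l: "l < length W" by simp
    have e: "along ?Z ((along X ^^ ?n) (h l)) = (along X ^^ Suc ?n) (h l) * wedge (\<theta> l) (\<theta> m)"
      using along_first_integral[OF l first_integral_along_funpow[OF l h[OF l]], where Z = ?Z]
      by (simp add: Z)
    show "along ?Z (?c l * (along X ^^ ?n) (h l)) = along ?Z (?c l) * (along X ^^ ?n) (h l)
        + (wedge (\<theta> l) (\<theta> m) * ?c l) * (along X ^^ Suc ?n) (h l)"
      unfolding along_mult e by (simp only: mult.assoc mult.commute mult.left_commute)
  qed
  finally have "(\<Sum>l<length W. along ?Z (?c l) * (along X ^^ ?n) (h l))
      + (\<Sum>l<length W. (wedge (\<theta> l) (\<theta> m) * ?c l) * (along X ^^ Suc ?n) (h l)) \<in> jet_ideal h (Suc ?n)" .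
  moreover have "(\<Sum>l<length W. along ?Z (?c l) * (along X ^^ ?n) (h l)) \<in> jet_ideal h (Suc ?n)"
    by (rule jet_ideal_sum, rule jet_ideal_scale, rule jet_ideal_base) simp_all
  ultimately have "(\<Sum>l<length W. (wedge (\<theta> l) (\<theta> m) * ?c l) * (along X ^^ Suc ?n) (h l)) \<in> jet_ideal h (Suc ?n)"
    unfolding jet_ideal_def by (simp only: module.span_add_eq[OF germ_module])
  then show ?case using insert.hyps by simp
qed

text \<open>
  Eliminating all foliations but the i-th leaves a relation whose only top order term is a unit
  times the derivative of \<open>h i\<close> of order \<open>length W - 1\<close>. Hence the coefficients of an abelian relation
  satisfy linear differential equations of that order.
\<close>

lemma jet_ideal_stationary:
  assumes h: "\<And>l. l < length W \<Longrightarrow> first_integral l (h l)" and sum: "(\<Sum>l<length W. h l) = 0"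
  shows "jet_ideal h (length W) \<subseteq> jet_ideal h (length W - 1)"
proof -
  let ?n = "length W - 1"
  have "(along X ^^ ?n) (h i) \<in> jet_ideal h ?n" if i: "i < length W" for i
  proof -
    let ?T = "{..<length W} - {i}"
    let ?c = "\<lambda>l. \<Prod>m\<in>?T. wedge (\<theta> l) (\<theta> m)"
    have T: "card ?T = ?n" using i by simp
    have "(\<Sum>l<length W. ?c l * (along X ^^ ?n) (h l)) \<in> jet_ideal h ?n"
      using jet_ideal_elimination[OF h sum, of ?T] unfolding T by simp
    also have "(\<Sum>l<length W. ?c l * (along X ^^ ?n) (h l)) = (\<Sum>l\<in>{i}. ?c l * (along X ^^ ?n) (h l))"
    proof (rule sum.mono_neutral_right)
      have "?c l = 0" if "l \<in> {..<length W} - {i}" for l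
        using that by (intro prod_zero bexI[of _ l]) auto
      then show "\<forall>l\<in>{..<length W} - {i}. ?c l * (along X ^^ ?n) (h l) = 0" by simp
    qed (use i in auto)
    finally have 1: "?c i * (along X ^^ ?n) (h i) \<in> jet_ideal h ?n" by simp
    have "val0 (?c i) \<noteq> 0"
      using wedge_nonzero i by (simp add: val0_prod)
    then obtain v where v: "?c i * v = 1" by (rule germ_unit_inverse)
    have "v * (?c i * (along X ^^ ?n) (h i)) = (?c i * v) * (along X ^^ ?n) (h i)"
      by (simp only: mult.assoc mult.commute mult.left_commute)
    also have "\<dots> = (along X ^^ ?n) (h i)" by (simp only: v mult_1)
    finally show ?thesis using jet_ideal_scale[OF 1, of v] by simp
  qed
  then have "(along X ^^ j) (h l) \<in> jet_ideal h ?n" if "j < length W" "l < length W" for j l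
    using jet_ideal_base[of j ?n l h] that by (cases "j = ?n") auto
  then have "{(along X ^^ j) (h l) | j l. j < length W \<and> l < length W} \<subseteq> jet_ideal h ?n"
    by auto
  then show ?thesis
    unfolding jet_ideal_def[of h "length W"]
    by (rule module.span_minimal[OF germ_module]) (simp add: jet_ideal_def module.subspace_span[OF germ_module])
qed

text \<open>
  Since the chain of ideals is stationary, the ideal is closed under all derivations, and the
  identity theorem applies to it.
\<close>

lemma relation_zero_if_jets_vanish:
  assumes h: "\<And>l. l < length W \<Longrightarrow> first_integral l (h l)" and sum: "(\<Sum>l<length W. h l) = 0"
    and val0: "\<And>j l. j < length W \<Longrightarrow> l < length W \<Longrightarrow> val0 ((along X ^^ j) (h l)) = 0"
    and i: "i < length W"
  shows "h i = 0"
proof (rule D_closed_vanishing_imp_zero[of "jet_ideal h (length W)"])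
  have along: "along Z a \<in> jet_ideal h (length W)" if "a \<in> jet_ideal h (length W)" for Z a
  proof -
    have "along Z a \<in> jet_ideal h (Suc (length W - 1))"
      using jet_ideal_along[OF h] jet_ideal_stationary[OF h sum] that by blast
    moreover have "Suc (length W - 1) = length W" using i by linarith
    ultimately show ?thesis by (simp only:)
  qed
  show "D1 a \<in> jet_ideal h (length W)" if "a \<in> jet_ideal h (length W)" for a
    using along[OF that, of "(1, 0)"] by (simp add: along_def contract1_def ext_d0_def)
  show "D2 a \<in> jet_ideal h (length W)" if "a \<in> jet_ideal h (length W)" for a
    using along[OF that, of "(0, 1)"] by (simp add: along_def contract1_def ext_d0_def)
  show "val0 a = 0" if "a \<in> jet_ideal h (length W)" for a
    using that unfolding jet_ideal_def
    by (induction a rule: module.span_induct_alt[OF germ_module, consumes 1, case_names base step]) (use val0 in auto)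
  show "h i \<in> jet_ideal h (length W)"
    using jet_ideal_base[of 0 "length W" i h] i by (cases W) auto
qed

lemma abelian_relations_web:
  "\<eta> \<in> abelian_relations W \<longleftrightarrow>
     (\<forall>i<length W. ext_d1 (\<eta> i) = 0 \<and> wedge (\<eta> i) (\<theta> i) = 0)
     \<and> (\<forall>i\<ge>length W. \<eta> i = 0) \<and> (\<Sum>i<length W. \<eta> i) = 0"
  by (auto simp: abelian_relations_def vanishes_iff)

lemma abelian_relations_extended_web:
  "\<eta> \<in> abelian_relations (W @ [foliation_of X]) \<longleftrightarrow>
     (\<forall>i<length W. ext_d1 (\<eta> i) = 0 \<and> wedge (\<eta> i) (\<theta> i) = 0)
     \<and> ext_d1 (\<eta> (length W)) = 0 \<and> contract1 X (\<eta> (length W)) = 0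
     \<and> (\<forall>i>length W. \<eta> i = 0) \<and> (\<Sum>i<length W. \<eta> i) + \<eta> (length W) = 0"
  by (auto simp: abelian_relations_def vanishes_iff nth_append less_Suc_eq Suc_le_eq
      vanishes_on_leaves_foliation_of[OF X_nonzero])

lemma closed_form_coefficient:
  assumes "i < length W" "ext_d1 \<eta> = 0" "wedge \<eta> (\<theta> i) = 0"
  shows "\<eta> = contract1 X \<eta> \<cdot> \<theta> i" "first_integral i (contract1 X \<eta>)"
proof -
  show e: "\<eta> = contract1 X \<eta> \<cdot> \<theta> i"
    by (rule wedge_zero_normalised[OF assms(3) normalised[OF assms(1)]])
  have "ext_d1 (contract1 X \<eta> \<cdot> \<theta> i) = 0" using assms(2) e by simp
  then show "first_integral i (contract1 X \<eta>)"
    using assms(1) by (simp add: ext_d1_gmult closed first_integral_def)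
qed

lemma subspace_abelian_relations: "tuples.subspace (abelian_relations W)"
  unfolding tuples.subspace_def
proof (intro conjI ballI allI)
  show "0 \<in> abelian_relations W"
    by (simp add: abelian_relations_web)
next
  fix \<eta> \<zeta> assume "\<eta> \<in> abelian_relations W" "\<zeta> \<in> abelian_relations W"
  then show "\<eta> + \<zeta> \<in> abelian_relations W"
    by (simp add: abelian_relations_web sum.distrib)
next
  fix c \<eta> assume \<eta>: "\<eta> \<in> abelian_relations W"
  have "(\<Sum>i<length W. germ_const c \<cdot> \<eta> i) = germ_const c \<cdot> (\<Sum>i<length W. \<eta> i)"
    by (rule gmult_sum_right[symmetric])
  then show "tuple_scale c \<eta> \<in> abelian_relations W"
    using \<eta> by (simp add: abelian_relations_web tuple_scale_gmult ext_d1_gmult)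
qed

lemma subspace_abelian_relations_extended:
  "tuples.subspace (abelian_relations (W @ [foliation_of X]))"
  unfolding tuples.subspace_def
proof (intro conjI ballI allI)
  show "0 \<in> abelian_relations (W @ [foliation_of X])"
    by (simp add: abelian_relations_extended_web)
next
  fix \<eta> \<zeta> assume a: "\<eta> \<in> abelian_relations (W @ [foliation_of X])" "\<zeta> \<in> abelian_relations (W @ [foliation_of X])"
  have "(\<Sum>i<length W. (\<eta> + \<zeta>) i) + (\<eta> + \<zeta>) (length W) =
      ((\<Sum>i<length W. \<eta> i) + \<eta> (length W)) + ((\<Sum>i<length W. \<zeta> i) + \<zeta> (length W))"
    by (simp add: sum.distrib)
  also have "\<dots> = 0"
    using a unfolding abelian_relations_extended_web by simp
  finally show "\<eta> + \<zeta> \<in> abelian_relations (W @ [foliation_of X])"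
    using a unfolding abelian_relations_extended_web by simp
next
  fix c \<eta> assume a: "\<eta> \<in> abelian_relations (W @ [foliation_of X])"
  have "(\<Sum>i<length W. tuple_scale c \<eta> i) + tuple_scale c \<eta> (length W) =
      germ_const c \<cdot> ((\<Sum>i<length W. \<eta> i) + \<eta> (length W))"
    by (simp add: tuple_scale_gmult gmult_sum_right)
  also have "\<dots> = 0"
    using a unfolding abelian_relations_extended_web by simp
  finally show "tuple_scale c \<eta> \<in> abelian_relations (W @ [foliation_of X])"
    using a unfolding abelian_relations_extended_web by (simp add: tuple_scale_gmult ext_d1_gmult)
qed

text \<open>
  An abelian relation is determined by the values at 0 of finitely many derivatives of its
  coefficients.
\<close>

lemma abelian_relations_finite_dim:
  obtains B where "finite B" "abelian_relations W \<subseteq> tuples.span B"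
proof (rule tuples.finite_spanning_set_of_separating_functionals[OF _ subspace_abelian_relations])
  let ?N = "{..<length W} \<times> {..<length W}"
  let ?\<phi> = "\<lambda>n (\<eta> :: nat \<Rightarrow> one_form). val0 ((along X ^^ fst n) (contract1 X (\<eta> (snd n))))"
  show "finite ?N" by simp
  show "?\<phi> n (\<eta> + \<zeta>) = ?\<phi> n \<eta> + ?\<phi> n \<zeta>" for n \<eta> \<zeta>
    by (simp add: along_funpow_linear)
  show "?\<phi> n (tuple_scale c \<eta>) = c * ?\<phi> n \<eta>" for n c \<eta>
    by (simp add: tuple_scale_gmult along_funpow_linear)
  show "\<eta> = 0" if \<eta>: "\<eta> \<in> abelian_relations W" and "\<forall>n\<in>?N. ?\<phi> n \<eta> = 0" for \<eta>
  proof
    fix i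
    have "contract1 X (\<Sum>i<length W. \<eta> i) = 0"
      using \<eta> by (simp add: abelian_relations_web)
    then have "contract1 X (\<eta> i) = 0" if "i < length W"
      using relation_zero_if_jets_vanish[of "\<lambda>l. contract1 X (\<eta> l)" i]
        closed_form_coefficient(2) \<eta> \<open>\<forall>n\<in>?N. ?\<phi> n \<eta> = 0\<close> that
      by (auto simp: abelian_relations_web contract1_sum)
    then have "\<eta> i = 0" if "i < length W"
      using closed_form_coefficient(1)[of i "\<eta> i"] \<eta> that
      by (simp add: abelian_relations_web)
    then show "\<eta> i = 0 i"
      using \<eta> by (cases "i < length W") (auto simp: abelian_relations_web)
  qed
qed (rule that)

section \<open>The Lie derivative on abelian relations\<close>

definition tuple_lie_deriv :: "(nat \<Rightarrow> one_form) \<Rightarrow> nat \<Rightarrow> one_form" where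
  "tuple_lie_deriv \<eta> i = lie_deriv X (\<eta> i)"

lemma lie_deriv_coefficient:
  assumes "i < length W" "ext_d1 \<eta> = 0" "wedge \<eta> (\<theta> i) = 0"
  shows "ext_d1 (lie_deriv X \<eta>) = 0" "wedge (lie_deriv X \<eta>) (\<theta> i) = 0"
  using closed_form_coefficient(2)[OF assms] assms(2)
  by (simp_all add: lie_deriv_closed first_integral_def)

text \<open>
  The component along the orbits of X is closed and annihilated by contraction with X, so its
  Lie derivative is 0 and the remaining components form a relation of W.
\<close>

lemma tuple_lie_deriv_maps:
  assumes \<eta>: "\<eta> \<in> abelian_relations (W @ [foliation_of X])"
  shows "tuple_lie_deriv \<eta> \<in> abelian_relations W"
proof -
  have last: "lie_deriv X (\<eta> (length W)) = 0"
    using \<eta> by (simp add: abelian_relations_extended_web lie_deriv_closed)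
  moreover have "lie_deriv X (\<eta> i) = 0" if "i > length W" for i
    using \<eta> that by (simp add: abelian_relations_extended_web)
  ultimately have "lie_deriv X (\<eta> i) = 0" if "i \<ge> length W" for i
    using that by (cases "i = length W") auto
  moreover have "lie_deriv X ((\<Sum>i<length W. \<eta> i) + \<eta> (length W)) = 0"
    using \<eta> unfolding abelian_relations_extended_web by simp
  then have "(\<Sum>i<length W. lie_deriv X (\<eta> i)) = 0"
    by (simp add: lie_deriv_sum last)
  ultimately show ?thesis
    using \<eta> lie_deriv_coefficient
    by (auto simp: abelian_relations_web abelian_relations_extended_web tuple_lie_deriv_def)
qed

text \<open>
  If \<open>\<eta> i = dg\<^sub>i\<close> and \<open>\<zeta>\<^sub>i = g\<^sub>i \<theta> i\<close>, then \<open>L\<^sub>X \<zeta>\<^sub>i = d(\<zeta>\<^sub>i(X)) = \<eta> i\<close>. The sum of the \<open>\<zeta>\<^sub>i\<close>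
  contracts with X to the constant \<open>\<Sum>i. g\<^sub>i\<close>. When this constant is 0, minus the sum is a closed form that
  vanishes on the orbits of X and completes the \<open>\<zeta>\<^sub>i\<close> to a relation of the extended web.
\<close>

lemma tuple_lie_deriv_onto:
  assumes W: "W \<noteq> []" and \<eta>: "\<eta> \<in> abelian_relations W"
  obtains \<zeta> where "\<zeta> \<in> abelian_relations (W @ [foliation_of X])" "tuple_lie_deriv \<zeta> = \<eta>"
proof -
  let ?k = "length W"
  have \<eta>': "\<And>i. i < ?k \<Longrightarrow> ext_d1 (\<eta> i) = 0 \<and> wedge (\<eta> i) (\<theta> i) = 0" "\<And>i. i \<ge> ?k \<Longrightarrow> \<eta> i = 0"
    "(\<Sum>i<?k. \<eta> i) = 0"
    using \<eta> by (simp_all add: abelian_relations_web)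
  have "\<forall>i\<in>{..<?k}. \<exists>g. ext_d0 g = \<eta> i"
    using \<eta>'(1) poincare by (metis lessThan_iff)
  then obtain g0 where g0: "\<And>i. i < ?k \<Longrightarrow> ext_d0 (g0 i) = \<eta> i"
    by (metis lessThan_iff)
  have "ext_d0 (\<Sum>i<?k. g0 i) = 0"
    using g0 \<eta>'(3) by (simp add: ext_d0_sum)
  then obtain c where c: "(\<Sum>i<?k. g0 i) = germ_const c"
    using D_zero_imp_const by (auto simp: ext_d0_def zero_prod_def)
  \<comment> \<open>shift one primitive so that they sum to 0\<close>
  define g where "g i = g0 i - (if i = 0 then germ_const c else 0)" for i
  have dg: "ext_d0 (g i) = \<eta> i" if "i < ?k" for i
    using g0[OF that] by (simp add: g_def)
  have sg: "(\<Sum>i<?k. g i) = 0"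
    using W c by (simp add: g_def sum_subtractf sum.delta)
  define \<zeta> where "\<zeta> i = (if i < ?k then g i \<cdot> \<theta> i else if i = ?k then - (\<Sum>j<?k. g j \<cdot> \<theta> j) else 0)" for i
  have closed_\<zeta>: "ext_d1 (g i \<cdot> \<theta> i) = 0" if "i < ?k" for i
    using that dg \<eta>'(1) closed by (simp add: ext_d1_gmult)
  have contr: "contract1 X (\<Sum>j<?k. g j \<cdot> \<theta> j) = 0"
    using sg by (simp add: contract1_sum normalised)
  have \<zeta>: "\<zeta> \<in> abelian_relations (W @ [foliation_of X])"
    unfolding abelian_relations_extended_web
    by (auto simp: \<zeta>_def closed_\<zeta> contr ext_d1_sum)
  moreover have "tuple_lie_deriv \<zeta> = \<eta>"
  proof
    fix i show "tuple_lie_deriv \<zeta> i = \<eta> i"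
    proof (cases "i < ?k")
      case True
      then show ?thesis
        by (simp add: tuple_lie_deriv_def \<zeta>_def lie_deriv_closed closed_\<zeta> normalised dg)
    next
      case False
      then show ?thesis
        using tuple_lie_deriv_maps[OF \<zeta>] \<eta>'(2) by (simp add: abelian_relations_web)
    qed
  qed
  ultimately show thesis by (rule that)
qed

section \<open>Relations annihilated by the Lie derivative\<close>

text \<open>
  A relation has zero Lie derivative iff its components along W are constant multiples
  \<open>c\<^sub>i \<theta> i\<close> with \<open>\<Sum>i. c\<^sub>i = 0\<close>. These are the relations of the basis of such coefficient vectors that has
  \<open>c\<^sub>i = 1\<close>, \<open>c\<^sub>0 = - 1\<close> and all other entries 0. The last component is minus the sum of the others.
\<close>

definition kernel_relation :: "nat \<Rightarrow> nat \<Rightarrow> one_form" where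
  "kernel_relation i = (\<lambda>j. if j = 0 then - \<theta> 0 else if j = length W then \<theta> 0 - \<theta> i
     else if j = i then \<theta> i else 0)"

lemma kernel_relation_sum:
  assumes "j \<in> {1..<length W}"
  shows "(\<Sum>i\<in>{1..<length W}. tuple_scale (c i) (kernel_relation i)) j = germ_const (c j) \<cdot> \<theta> j"
proof -
  have "(\<Sum>i\<in>{1..<length W}. tuple_scale (c i) (kernel_relation i)) j =
      (\<Sum>i\<in>{1..<length W}. if j = i then germ_const (c i) \<cdot> \<theta> i else 0)"
    unfolding tuple_sum_apply
    by (rule sum.cong) (use assms in \<open>auto simp: tuple_scale_gmult kernel_relation_def\<close>)
  then show ?thesis using assms by (simp add: sum.delta')
qed

lemma kernel_relation_in_kernel:
  assumes "i \<in> {1..<length W}"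
  shows "kernel_relation i \<in> {\<eta> \<in> abelian_relations (W @ [foliation_of X]). tuple_lie_deriv \<eta> = 0}"
proof -
  have k: "0 < length W" "i < length W" using assms by auto
  have "(\<Sum>j<length W. kernel_relation i j) = (\<Sum>j<length W. (if j = 0 then - \<theta> 0 else 0) + (if j = i then \<theta> i else 0))"
    by (rule sum.cong) (use assms in \<open>auto simp: kernel_relation_def\<close>)
  also have "\<dots> = - \<theta> 0 + \<theta> i"
    using k by (simp add: sum.distrib sum.delta)
  finally have s: "(\<Sum>j<length W. kernel_relation i j) = - \<theta> 0 + \<theta> i" .
  have "kernel_relation i \<in> abelian_relations (W @ [foliation_of X])"
    unfolding abelian_relations_extended_web s
    using k by (auto simp: kernel_relation_def closed normalised)
  moreover have "tuple_lie_deriv (kernel_relation i) = 0"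
    using k by (auto simp: tuple_lie_deriv_def kernel_relation_def fun_eq_iff lie_deriv_closed closed normalised)
  ultimately show ?thesis by simp
qed

text \<open>
  If only the components along the foliation with index 0 and along the orbits of X remain, they cancel,
  and so the former also contracts with X to 0.
\<close>

lemma relation_zero_if_almost_all_zero:
  assumes W: "W \<noteq> []" and \<eta>: "\<eta> \<in> abelian_relations (W @ [foliation_of X])"
    and zero: "\<And>i. i \<in> {1..<length W} \<Longrightarrow> \<eta> i = 0"
  shows "\<eta> = 0"
proof -
  let ?k = "length W"
  have k: "0 < ?k" using W by simp
  have "(\<Sum>i<?k. \<eta> i) = (\<Sum>i\<in>{0}. \<eta> i)"
    by (rule sum.mono_neutral_right) (use k zero in auto)
  then have s: "\<eta> 0 + \<eta> ?k = 0"
    using \<eta> by (simp add: abelian_relations_extended_web)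
  then have "contract1 X (\<eta> 0 + \<eta> ?k) = 0" by simp
  then have "contract1 X (\<eta> 0) = 0"
    using \<eta> by (simp add: abelian_relations_extended_web)
  moreover have "\<eta> 0 = contract1 X (\<eta> 0) \<cdot> \<theta> 0"
    using closed_form_coefficient(1)[OF k] \<eta> k by (simp add: abelian_relations_extended_web)
  ultimately have "\<eta> 0 = 0" by simp
  moreover from this s have "\<eta> ?k = 0" by simp
  moreover have "\<eta> i = 0" if "i > ?k" for i
    using \<eta> that by (simp add: abelian_relations_extended_web)
  ultimately have "\<eta> i = 0" for i
    using zero[of i] by (cases "i = 0 \<or> i = ?k \<or> i > ?k") auto
  then show ?thesis by (simp add: fun_eq_iff)
qed

lemma kernel_spanned:
  assumes W: "W \<noteq> []"
  shows "{\<eta> \<in> abelian_relations (W @ [foliation_of X]). tuple_lie_deriv \<eta> = 0}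
    \<subseteq> tuples.span (kernel_relation ` {1..<length W})"
    (is "?K \<subseteq> tuples.span (kernel_relation ` ?I)")
proof
  fix \<eta> assume "\<eta> \<in> ?K"
  then have \<eta>: "\<eta> \<in> abelian_relations (W @ [foliation_of X])" "\<And>i. lie_deriv X (\<eta> i) = 0"
    by (auto simp: tuple_lie_deriv_def fun_eq_iff)
  \<comment> \<open>the coefficient is a primitive of the Lie derivative, hence constant\<close>
  have const: "\<exists>c. \<eta> i = germ_const c \<cdot> \<theta> i" if "i < length W" for i
  proof -
    have i: "ext_d1 (\<eta> i) = 0" "wedge (\<eta> i) (\<theta> i) = 0"
      using \<eta>(1) that by (simp_all add: abelian_relations_extended_web)
    have "ext_d0 (contract1 X (\<eta> i)) = 0"
      using \<eta>(2)[of i] i by (simp add: lie_deriv_closed)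
    then have "contract1 X (\<eta> i) = germ_const (val0 (contract1 X (\<eta> i)))"
      by (intro D_zero_imp_const) (simp_all add: ext_d0_def zero_prod_def)
    then show ?thesis
      using closed_form_coefficient(1)[OF that i] by metis
  qed
  then obtain c where c: "\<And>i. i < length W \<Longrightarrow> \<eta> i = germ_const (c i) \<cdot> \<theta> i" by metis
  let ?s = "\<Sum>i\<in>?I. tuple_scale (c i) (kernel_relation i)"
  have span: "?s \<in> tuples.span (kernel_relation ` ?I)"
    by (intro tuples.span_sum tuples.span_scale tuples.span_base) auto
  have "?s \<in> abelian_relations (W @ [foliation_of X])"
    by (intro tuples.subspace_sum tuples.subspace_scale subspace_abelian_relations_extended)
      (use kernel_relation_in_kernel in auto)
  then have diff: "\<eta> - ?s \<in> abelian_relations (W @ [foliation_of X])"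
    by (intro tuples.subspace_diff subspace_abelian_relations_extended \<eta>(1))
  have "(\<eta> - ?s) i = 0" if "i \<in> ?I" for i
    using kernel_relation_sum[OF that, of c] c[of i] that by simp
  from relation_zero_if_almost_all_zero[OF W diff this] have "\<eta> = ?s"
    by (simp only: right_minus_eq)
  then show "\<eta> \<in> tuples.span (kernel_relation ` ?I)" using span by simp
qed

lemma dim_kernel:
  assumes W: "W \<noteq> []"
  shows "tuples.dim {\<eta> \<in> abelian_relations (W @ [foliation_of X]). tuple_lie_deriv \<eta> = 0} = length W - 1"
    (is "tuples.dim ?K = _")
proof -
  let ?k = "length W" and ?I = "{1..<length W}"
  have indep0: "c j = 0" if "(\<Sum>i\<in>?I. tuple_scale (c i) (kernel_relation i)) = 0" "j \<in> ?I" for c j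
  proof -
    have "contract1 X (germ_const (c j) \<cdot> \<theta> j) = 0"
      using kernel_relation_sum[OF that(2), of c] that(1) by simp
    then have "germ_const (c j) = 0" using that(2) by (simp add: normalised)
    then show ?thesis by (metis val0_simps(1,3))
  qed
  have inj: "inj_on kernel_relation ?I"
  proof (rule inj_onI)
    fix i j assume ij: "i \<in> ?I" "j \<in> ?I" "kernel_relation i = kernel_relation j"
    have "contract1 X (\<theta> i) = 1" using ij by (simp add: normalised)
    then have "kernel_relation i i \<noteq> 0" using ij(1) by (auto simp: kernel_relation_def)
    then have "kernel_relation j i \<noteq> 0" using ij(3) by simp
    then show "i = j" using ij(1,2) by (auto simp: kernel_relation_def split: if_splits)
  qed
  have "tuples.independent (kernel_relation ` ?I)"
  proof (rule tuples.independent_if_scalars_zero)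
    fix u x assume s: "(\<Sum>x\<in>kernel_relation ` ?I. tuple_scale (u x) x) = 0" and "x \<in> kernel_relation ` ?I"
    then obtain j where "j \<in> ?I" "x = kernel_relation j" by blast
    then show "u x = 0"
      using indep0[of "\<lambda>i. u (kernel_relation i)" j] s unfolding sum.reindex[OF inj] o_def by blast
  qed simp
  moreover have "kernel_relation ` ?I \<subseteq> ?K"
    using kernel_relation_in_kernel by blast
  moreover have "?K \<subseteq> tuples.span (kernel_relation ` ?I)"
    by (rule kernel_spanned[OF W])
  moreover have "card (kernel_relation ` ?I) = ?k - 1"
    using inj by (simp add: card_image)
  ultimately show ?thesis by (intro tuples.dim_unique)
qed

lemma web_rank_extended:
  assumes W: "W \<noteq> []"
  shows "web_rank (W @ [foliation_of X]) = web_rank W + (length W - 1)"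
proof -
  let ?V = "abelian_relations (W @ [foliation_of X])"
  let ?K = "{\<eta> \<in> ?V. tuple_lie_deriv \<eta> = 0}"
  have image: "tuple_lie_deriv ` ?V = abelian_relations W"
    using tuple_lie_deriv_maps tuple_lie_deriv_onto[OF W] by (auto simp: image_iff) metis
  obtain D where D: "finite D" "abelian_relations W \<subseteq> tuples.span D"
    by (rule abelian_relations_finite_dim)
  have "tuples.dim ?V = tuples.dim ?K + tuples.dim (tuple_lie_deriv ` ?V)"
  proof (rule tuples.rank_nullity[OF subspace_abelian_relations_extended])
    show "tuple_lie_deriv (\<eta> + \<zeta>) = tuple_lie_deriv \<eta> + tuple_lie_deriv \<zeta>" for \<eta> \<zeta>
      by (simp add: tuple_lie_deriv_def fun_eq_iff)
    show "tuple_lie_deriv (tuple_scale c \<eta>) = tuple_scale c (tuple_lie_deriv \<eta>)" for c \<eta>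
      by (simp add: tuple_lie_deriv_def fun_eq_iff tuple_scale_gmult)
    show "finite (kernel_relation ` {1..<length W})" by simp
    show "?K \<subseteq> tuples.span (kernel_relation ` {1..<length W})"
      by (rule kernel_spanned[OF W])
    show "finite D" "tuple_lie_deriv ` ?V \<subseteq> tuples.span D"
      using D image by simp_all
  qed
  then show ?thesis
    by (simp add: web_rank_def image dim_kernel[OF W])
qed

end

section \<open>The rank of the extended web\<close>

lemma symmetric_web_exists:
  assumes "regular_web W" "transverse_inf_automorphism X W"
  obtains \<theta> where "symmetric_web W X \<theta>"
proof -
  have "\<forall>i\<in>{..<length W}. \<exists>\<theta>. ext_d1 \<theta> = 0 \<and> contract1 X \<theta> = 1 \<and> at0 \<theta> \<noteq> 0 \<and> W ! i = abs_foliation \<theta>"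
    using assms(2) preserved_foliation_normal_form nth_mem
    unfolding transverse_inf_automorphism_def by (metis lessThan_iff)
  then obtain \<theta> where \<theta>: "\<And>i. i < length W \<Longrightarrow>
      ext_d1 (\<theta> i) = 0 \<and> contract1 X (\<theta> i) = 1 \<and> at0 (\<theta> i) \<noteq> 0 \<and> W ! i = abs_foliation (\<theta> i)"
    by (metis lessThan_iff)
  have "tangent_space0 (W ! i) \<noteq> tangent_space0 (W ! j)" if "i < length W" "j < length W" "i \<noteq> j" for i j
    using assms(1) that by (auto simp: regular_web_def distinct_conv_nth)
  then have "val0 (wedge (\<theta> i) (\<theta> j)) \<noteq> 0" if "i < length W" "j < length W" "i \<noteq> j" for i j
    using distinct_tangents_imp_wedge_nonzero[of X "\<theta> i" "\<theta> j"] \<theta>[OF that(1)] \<theta>[OF that(2)] that by metis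
  then have "symmetric_web W X \<theta>"
    using \<theta> assms(2)
    by unfold_locales (auto simp: transverse_inf_automorphism_def vanishes_on_leaves_abs_foliation)
  then show thesis by (rule that)
qed

theorem theorem1:
  fixes W :: "foliation list" and X :: vector_field
  assumes "W \<noteq> []"
    and "regular_web W"
    and "transverse_inf_automorphism X W"
  shows "web_rank (W @ [foliation_of X]) = web_rank W + (length W - 1)
    \<and> (maximal_rank W \<longleftrightarrow> maximal_rank (W @ [foliation_of X]))"
proof -
  obtain \<theta> where "symmetric_web W X \<theta>"
    using symmetric_web_exists[OF assms(2,3)] .
  then have rank: "web_rank (W @ [foliation_of X]) = web_rank W + (length W - 1)"
    using assms(1) by (rule symmetric_web.web_rank_extended)
  obtain m where m: "length W = Suc m"
    using assms(1) by (cases W) auto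
  \<comment> \<open>the two Bol bounds differ by m\<close>
  have "Suc m * m = m * (m - 1) + 2 * m"
    by (cases m) auto
  then have "Suc m * m div 2 = m * (m - 1) div 2 + m" by simp
  then show ?thesis
    using rank by (simp add: maximal_rank_def m)
qed

end
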